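(* ${\mathrm{LDT}}$ polynomially simulates $1$-${\mathrm{LK}}$. Moreover, tree-like ${\mathrm{LDT}}$ polynomially simulates tree-like $1$-${\mathrm{LK}}$. Explicitly: there is a polynomial-time procedure which, given a $1$-${\mathrm{LK}}$ proof (resp. a tree-like $1$-${\mathrm{LK}}$ proof) of a sequent $\bigvee \vec a_0,\dots,\bigvee \vec a_{m-1} \to \bigwedge \vec b_0,\dots,\bigwedge \vec b_{n-1}$, where the $\vec a_i,\vec b_j$ are nonempty sequences of literals, outputs an ${\mathrm{LDT}}$ proof (resp. a tree-like ${\mathrm{LDT}}$ proof) of ${\mathrm{Disj}}(\vec a_0),\dots,{\mathrm{Disj}}(\vec a_{m-1}) \to {\mathrm{Conj}}(\vec b_0),\dots,{\mathrm{Conj}}(\vec b_{n-1})$.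
   Context: A literal is a propositional variable $x$ or its negation $\overline x$; $p,q,\dots$ range over literals, and $\overline{\overline x}=x$. Decision tree (DT) formulas are defined inductively: every literal is a DT formula, and if $A,B$ are DT formulas and $p$ is a literal then $(ApB)$ is a DT formula, meaning "if $p$ is false then $A$, else $B$". Under a truth assignment $\alpha$, $\alpha(ApB)=\alpha(A)$ if $\alpha(p)=0$ and $\alpha(B)$ otherwise. The size of a formula is the number of occurrences of atomic formulas in it; the size of a proof is the sum of the sizes of the formulas in it. Sequents are $\Gamma\to\Delta$ with $\Gamma,\Delta$ finite multisets of formulas. The sequent calculus ${\mathrm{LDT}}$ has lines that are sequents of DT formulas, initial sequents $p\to p$, $p,\overline p\to$, $\to p,\overline p$ for literals $p$, and rules: contraction (from $A,A,\Gamma\to\Delta$ infer $A,\Gamma\to\Delta$; from $\Gamma\to\Delta,A,A$ infer $\Gamma\to\Delta,A$), weakening (from $\Gamma\to\Delta$ infer $A,\Gamma\to\Delta$ or $\Gamma\to\Delta,A$), cut (from $\Gamma\to\Delta,A$ and $A,\Gamma\to\Delta$ infer $\Gamma\to\Delta$), dec-l (from $A,\Gamma\to\Delta,p$ and $p,B,\Gamma\to\Delta$ infer $ApB,\Gamma\to\Delta$), and dec-r (from $\Gamma\to\Delta,A,p$ and $p,\Gamma\to\Delta,B$ infer $\Gamma\to\Delta,ApB$). Proofs are dag-like (sequences of sequents, each an initial sequent or inferred from earlier ones) unless specified tree-like. ${\mathrm{LK}}$ is the sequent calculus for Boolean formulas (built from literals by binary $\land,\lor$) with the same initial sequents, contraction,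 weakening and cut rules, and the rules: from $A,B,\Gamma\to\Delta$ infer $A\land B,\Gamma\to\Delta$; from $\Gamma\to\Delta,A$ and $\Gamma\to\Delta,B$ infer $\Gamma\to\Delta,A\land B$; from $A,\Gamma\to\Delta$ and $B,\Gamma\to\Delta$ infer $A\lor B,\Gamma\to\Delta$; from $\Gamma\to\Delta,A,B$ infer $\Gamma\to\Delta,A\lor B$. A clause is a disjunction of literals and a term is a conjunction of literals; for a sequence of literals $\vec p$, $\bigvee\vec p$ (resp. $\bigwedge\vec p$) denotes any disjunction (resp. conjunction) of the literals of $\vec p$ in the indicated order, with arbitrary nesting. A depth one formula is a clause or a term. $1$-${\mathrm{LK}}$ is ${\mathrm{LK}}$ restricted so that every formula in every sequent is depth one. For a nonempty sequence of literals, ${\mathrm{Conj}}(p):=p$, ${\mathrm{Conj}}(p,\vec p):=(p\,p\,{\mathrm{Conj}}(\vec p))$, ${\mathrm{Disj}}(p):=p$, ${\mathrm{Disj}}(p,\vec p):=({\mathrm{Disj}}(\vec p)\,p\,p)$. *)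

theory Defs
  imports "HOL-Library.Multiset"
begin

section \<open>Formulas\<close>

datatype lit = Pos nat | Neg nat

fun neg :: "lit \<Rightarrow> lit" where
  "neg (Pos x) = Neg x"
| "neg (Neg x) = Pos x"

text \<open>\<open>Dec A p B\<close> is the formula \<open>(ApB)\<close>: if \<open>p\<close> is false then \<open>A\<close>, else \<open>B\<close>.\<close>

datatype dt = DLit lit | Dec dt lit dt

datatype bf = BLit lit | And bf bf | Or bf bf

text \<open>\<open>is_Or ps A\<close>: \<open>A\<close> is a disjunction, with some nesting, of the literals \<open>ps\<close> in this
  order. A single literal is both a disjunction and a conjunction; nothing is a disjunction or a
  conjunction of the empty sequence.\<close>

inductive is_Or :: "lit list \<Rightarrow> bf \<Rightarrow> bool" where
  "is_Or [p] (BLit p)"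
| "is_Or ps A \<Longrightarrow> is_Or qs B \<Longrightarrow> is_Or (ps @ qs) (Or A B)"

inductive is_And :: "lit list \<Rightarrow> bf \<Rightarrow> bool" where
  "is_And [p] (BLit p)"
| "is_And ps A \<Longrightarrow> is_And qs B \<Longrightarrow> is_And (ps @ qs) (And A B)"

definition depth_one :: "bf \<Rightarrow> bool" where
  "depth_one A \<longleftrightarrow> (\<exists>ps. is_Or ps A) \<or> (\<exists>ps. is_And ps A)"

text \<open>Only meaningful on nonempty lists.\<close>

fun Conj :: "lit list \<Rightarrow> dt" where
  "Conj [p] = DLit p"
| "Conj (p # q # ps) = Dec (DLit p) p (Conj (q # ps))"

fun Disj :: "lit list \<Rightarrow> dt" where
  "Disj [p] = DLit p"
| "Disj (p # q # ps) = Dec (Disj (q # ps)) p (DLit p)"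

section \<open>Inference rules\<close>

type_synonym 'f sequent = "'f multiset \<times> 'f multiset"

text \<open>Inference relations relate the list of premises to the conclusion; initial sequents are
  inferences without premises. The initial sequents and structural rules are shared by the two
  calculi, whose formulas contain the literals via the embedding \<open>L\<close>.\<close>

inductive common_inf :: "(lit \<Rightarrow> 'f) \<Rightarrow> 'f sequent list \<Rightarrow> 'f sequent \<Rightarrow> bool"
  for L :: "lit \<Rightarrow> 'f" where
  init: "common_inf L [] ({#L p#}, {#L p#})"
| init_l: "common_inf L [] ({#L p, L (neg p)#}, {#})"
| init_r: "common_inf L [] ({#}, {#L p, L (neg p)#})"
| contr_l: "common_inf L [(add_mset A (add_mset A \<Gamma>), \<Delta>)] (add_mset A \<Gamma>, \<Delta>)"
| contr_r: "common_inf L [(\<Gamma>, add_mset A (add_mset A \<Delta>))] (\<Gamma>, add_mset A \<Delta>)"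
| weak_l: "common_inf L [(\<Gamma>, \<Delta>)] (add_mset A \<Gamma>, \<Delta>)"
| weak_r: "common_inf L [(\<Gamma>, \<Delta>)] (\<Gamma>, add_mset A \<Delta>)"
| cut: "common_inf L [(\<Gamma>, add_mset A \<Delta>), (add_mset A \<Gamma>, \<Delta>)] (\<Gamma>, \<Delta>)"

inductive ldt_inf :: "dt sequent list \<Rightarrow> dt sequent \<Rightarrow> bool" where
  common: "common_inf DLit Ps S \<Longrightarrow> ldt_inf Ps S"
| dec_l: "ldt_inf [(add_mset A \<Gamma>, add_mset (DLit p) \<Delta>), (add_mset (DLit p) (add_mset B \<Gamma>), \<Delta>)]
            (add_mset (Dec A p B) \<Gamma>, \<Delta>)"
| dec_r: "ldt_inf [(\<Gamma>, add_mset A (add_mset (DLit p) \<Delta>)), (add_mset (DLit p) \<Gamma>, add_mset B \<Delta>)]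
            (\<Gamma>, add_mset (Dec A p B) \<Delta>)"

inductive lk_inf :: "bf sequent list \<Rightarrow> bf sequent \<Rightarrow> bool" where
  common: "common_inf BLit Ps S \<Longrightarrow> lk_inf Ps S"
| and_l: "lk_inf [(add_mset A (add_mset B \<Gamma>), \<Delta>)] (add_mset (And A B) \<Gamma>, \<Delta>)"
| and_r: "lk_inf [(\<Gamma>, add_mset A \<Delta>), (\<Gamma>, add_mset B \<Delta>)] (\<Gamma>, add_mset (And A B) \<Delta>)"
| or_l: "lk_inf [(add_mset A \<Gamma>, \<Delta>), (add_mset B \<Gamma>, \<Delta>)] (add_mset (Or A B) \<Gamma>, \<Delta>)"
| or_r: "lk_inf [(\<Gamma>, add_mset A (add_mset B \<Delta>))] (\<Gamma>, add_mset (Or A B) \<Delta>)"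

text \<open>Every sequent of a proof is the conclusion of an inference, so it suffices to restrict
  conclusions.\<close>

definition lk1_inf :: "bf sequent list \<Rightarrow> bf sequent \<Rightarrow> bool" where
  "lk1_inf Ps S \<longleftrightarrow> lk_inf Ps S \<and> (\<forall>A \<in># fst S + snd S. depth_one A)"

section \<open>Proofs\<close>

text \<open>Neither kind of proof records which rule was applied.\<close>

definition dag_proof ::
  "('f sequent list \<Rightarrow> 'f sequent \<Rightarrow> bool) \<Rightarrow> 'f sequent list \<Rightarrow> 'f sequent \<Rightarrow> bool" where
  "dag_proof R \<pi> S \<longleftrightarrow> \<pi> \<noteq> [] \<and> last \<pi> = S \<and>
     (\<forall>i < length \<pi>. \<exists>Ps. set Ps \<subseteq> set (take i \<pi>) \<and> R Ps (\<pi> ! i))"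

text \<open>A tree-like proof is a tree of sequents; the children of a node are the premises.\<close>

datatype 's ptree = Infer (root: 's) "'s ptree list"

inductive valid_tree ::
  "('f sequent list \<Rightarrow> 'f sequent \<Rightarrow> bool) \<Rightarrow> 'f sequent ptree \<Rightarrow> bool"
  for R :: "'f sequent list \<Rightarrow> 'f sequent \<Rightarrow> bool" where
  "R (map root ts) S \<Longrightarrow> \<forall>t \<in> set ts. valid_tree R t \<Longrightarrow> valid_tree R (Infer S ts)"

definition tree_proof ::
  "('f sequent list \<Rightarrow> 'f sequent \<Rightarrow> bool) \<Rightarrow> 'f sequent ptree \<Rightarrow> 'f sequent \<Rightarrow> bool" where
  "tree_proof R t S \<longleftrightarrow> valid_tree R t \<and> root t = S"

section \<open>Polynomial time\<close>

text \<open>Programs operate on binary trees; the condition of \<open>PIf\<close> and \<open>PWhile\<close> counts as true unless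
  it yields \<open>Leaf\<close>. In the step-counting semantics \<open>runs P x t y\<close> (on input \<open>x\<close>, \<open>P\<close> halts after
  time \<open>t\<close> with output \<open>y\<close>) each basic operation is charged for reading its entire argument.
  Hence no value is bigger than the time spent, as \<open>runs_size\<close> below states, and polynomial time
  agrees with polynomial time on Turing machines.\<close>

datatype data = Leaf | Node data data

datatype prog =
    PId | PLeaf | PFst | PSnd | PEq
  | PPair prog prog | PComp prog prog | PIf prog prog prog | PWhile prog prog

inductive runs :: "prog \<Rightarrow> data \<Rightarrow> nat \<Rightarrow> data \<Rightarrow> bool" where
  "runs PId x (Suc (size x)) x"
| "runs PLeaf x (Suc (size x)) Leaf"
| "runs PFst Leaf (Suc (size Leaf)) Leaf"
| "runs PFst (Node x y) (Suc (size (Node x y))) x"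
| "runs PSnd Leaf (Suc (size Leaf)) Leaf"
| "runs PSnd (Node x y) (Suc (size (Node x y))) y"
| "runs PEq Leaf (Suc (size Leaf)) Leaf"
| "runs PEq (Node x y) (Suc (size (Node x y))) (if x = y then Node Leaf Leaf else Leaf)"
| "runs P x t y \<Longrightarrow> runs Q x u z \<Longrightarrow> runs (PPair P Q) x (Suc (t + u)) (Node y z)"
| "runs P x t y \<Longrightarrow> runs Q y u z \<Longrightarrow> runs (PComp P Q) x (Suc (t + u)) z"
| "runs C x t b \<Longrightarrow> b \<noteq> Leaf \<Longrightarrow> runs P x u y \<Longrightarrow> runs (PIf C P Q) x (Suc (t + u)) y"
| "runs C x t Leaf \<Longrightarrow> runs Q x u y \<Longrightarrow> runs (PIf C P Q) x (Suc (t + u)) y"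
| "runs C x t Leaf \<Longrightarrow> runs (PWhile C P) x (Suc t) x"
| "runs C x t b \<Longrightarrow> b \<noteq> Leaf \<Longrightarrow> runs P x u y \<Longrightarrow> runs (PWhile C P) y v z
     \<Longrightarrow> runs (PWhile C P) x (Suc (t + u + v)) z"

lemma runs_size: "runs P x t y \<Longrightarrow> size x < t \<and> size y \<le> t"
  by (induction rule: runs.induct) auto

inductive_cases runs_PIdE: "runs PId x t y"
inductive_cases runs_PLeafE: "runs PLeaf x t y"
inductive_cases runs_PFstE: "runs PFst x t y"
inductive_cases runs_PSndE: "runs PSnd x t y"
inductive_cases runs_PEqE: "runs PEq x t y"
inductive_cases runs_PPairE: "runs (PPair P Q) x t y"
inductive_cases runs_PCompE: "runs (PComp P Q) x t y"
inductive_cases runs_PIfE: "runs (PIf C P Q) x t y"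
inductive_cases runs_PWhileE: "runs (PWhile C P) x t y"

lemma runs_deterministic: "runs P x t y \<Longrightarrow> runs P x t' y' \<Longrightarrow> t' = t \<and> y' = y"
proof (induction arbitrary: t' y' rule: runs.induct)
  case 1 then show ?case by (auto elim: runs_PIdE)
next case 2 then show ?case by (auto elim: runs_PLeafE)
next case 3 then show ?case by (auto elim: runs_PFstE)
next case 4 then show ?case by (auto elim: runs_PFstE)
next case 5 then show ?case by (auto elim: runs_PSndE)
next case 6 then show ?case by (auto elim: runs_PSndE)
next case 7 then show ?case by (auto elim: runs_PEqE)
next case 8 then show ?case by (auto elim: runs_PEqE)
next case 9 from "9.prems" show ?case by (rule runs_PPairE) (use "9.IH" in blast)
next case 10 from "10.prems" show ?case by (rule runs_PCompE) (use "10.IH" in blast)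
next case 11 from "11.prems" show ?case by (rule runs_PIfE) (use "11.IH" "11.hyps" in blast)+
next case 12 from "12.prems" show ?case by (rule runs_PIfE) (use "12.IH" "12.hyps" in blast)+
next case 13 from "13.prems" show ?case by (rule runs_PWhileE) (use "13.IH" "13.hyps" in blast)+
next case 14 from "14.prems" show ?case by (rule runs_PWhileE) (use "14.IH" "14.hyps" in blast)+
qed

definition polytime :: "(data \<Rightarrow> data) \<Rightarrow> bool" where
  "polytime F \<longleftrightarrow> (\<exists>P c k. \<forall>x. \<exists>t. runs P x t (F x) \<and> t \<le> c * size x ^ k + c)"

section \<open>Proofs as inputs and outputs\<close>

text \<open>Programs get and return sequents with both multisets listed in an arbitrary order.\<close>

type_synonym 'f lsequent = "'f list \<times> 'f list"

definition seq_of :: "'f lsequent \<Rightarrow> 'f sequent" where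
  "seq_of s = (mset (fst s), mset (snd s))"

text \<open>Numbers (names of variables, and tags of constructors) are coded in binary.\<close>

fun enc_nat :: "nat \<Rightarrow> data" where
  "enc_nat n = (if n = 0 then Leaf
     else Node (if even n then Leaf else Node Leaf Leaf) (enc_nat (n div 2)))"

declare enc_nat.simps [simp del]

primrec enc_list :: "data list \<Rightarrow> data" where
  "enc_list [] = Leaf"
| "enc_list (x # xs) = Node x (enc_list xs)"

primrec enc_lit :: "lit \<Rightarrow> data" where
  "enc_lit (Pos x) = Node (enc_nat 0) (enc_nat x)"
| "enc_lit (Neg x) = Node (enc_nat 1) (enc_nat x)"

primrec enc_dt :: "dt \<Rightarrow> data" where
  "enc_dt (DLit p) = Node (enc_nat 0) (enc_lit p)"
| "enc_dt (Dec A p B) = Node (enc_nat 1) (Node (enc_dt A) (Node (enc_lit p) (enc_dt B)))"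

primrec enc_bf :: "bf \<Rightarrow> data" where
  "enc_bf (BLit p) = Node (enc_nat 0) (enc_lit p)"
| "enc_bf (And A B) = Node (enc_nat 1) (Node (enc_bf A) (enc_bf B))"
| "enc_bf (Or A B) = Node (enc_nat 2) (Node (enc_bf A) (enc_bf B))"

definition enc_seq :: "('f \<Rightarrow> data) \<Rightarrow> 'f lsequent \<Rightarrow> data" where
  "enc_seq e s = Node (enc_list (map e (fst s))) (enc_list (map e (snd s)))"

definition enc_dag :: "('f \<Rightarrow> data) \<Rightarrow> 'f lsequent list \<Rightarrow> data" where
  "enc_dag e \<pi> = enc_list (map (enc_seq e) \<pi>)"

primrec enc_tree :: "('f \<Rightarrow> data) \<Rightarrow> 'f lsequent ptree \<Rightarrow> data" where
  "enc_tree e (Infer s ts) = Node (enc_seq e s) (enc_list (map (enc_tree e) ts))"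

end

theory Submission
  imports Defs "HOL-Library.While_Combinator"
begin

text \<open>
  A 1-LK proof records neither its rules nor, if dag-like, its premises. Call a sequent closed if
  the literals of its left conjunctions and right disjunctions make one of its right conjunctions
  true or one of its left disjunctions false; closed sequents have short cut-free LDT proofs. Given
  a premise \<open>E\<close> of a sequent \<open>\<Omega>\<close>, weaken \<open>E\<close> by \<open>\<Omega>\<close> and cut away each formula of \<open>E\<close> whose negation
  closes \<open>\<Omega>\<close>. If \<open>E\<close> is the only premise, this leaves \<open>\<Omega>\<close>. If there are two premises, it leaves
  \<open>\<Omega>, u\<close> and \<open>\<Omega>, v\<close> for the active formulas \<open>u, v\<close>; since their negations together close \<open>\<Omega>\<close>,
  two cuts yield \<open>\<Omega>\<close>. All these steps are sound for arbitrary \<open>E\<close>. Hence a dag-like proof is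
  translated by performing them for all earlier lines and all pairs of formulas left over, and a
  tree-like proof by performing them for the children of each node, which uses every subtree once.
  The translation is composed from maps over lists, for which polynomial time is preserved
  unconditionally; only a few folds and the traversal of trees need size bounds.
\<close>

section \<open>Polynomial-time functions on trees\<close>

text \<open>Closedness is a monotone stand-in for validity that can be decided in polynomial time.
  It is far weaker than validity, and it suffices because depth one formulas are determined up to
  nesting by a type and a list of literals: the active formulas of a rule and its principal formula
  then consist of the same literals. Negating an item merely moves it to the other side, so that
  every cut formula is a translated formula of the given proof or a literal.

  No instruction of the stack machine copies a stack entry. A program therefore builds a tree with
  at most one node per instruction, and the size of a tree-like translation needs no analysis beyond
  that of its program.

  The obstacle on the computational side is that \<open>polytime\<close> demands a time bound on all
  data, including those that encode nothing. Hence size hypotheses are stated for arbitrary data,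
  and recursions on literals, lines and formulas are unrolled into maps over suffixes or over
  preorder listings.\<close>

inductive ispoly :: "(nat \<Rightarrow> nat) \<Rightarrow> bool" where
  ispoly_id: "ispoly (\<lambda>n. n)"
| ispoly_const: "ispoly (\<lambda>n. c)"
| ispoly_add: "ispoly p \<Longrightarrow> ispoly q \<Longrightarrow> ispoly (\<lambda>n. p n + q n)"
| ispoly_mult: "ispoly p \<Longrightarrow> ispoly q \<Longrightarrow> ispoly (\<lambda>n. p n * q n)"

lemma ispoly_comp:
  assumes "ispoly p" "ispoly q"
  shows "ispoly (\<lambda>n. p (q n))"
  using assms(1) by induction (auto intro: ispoly.intros assms(2))

lemma ispoly_Suc: "ispoly p \<Longrightarrow> ispoly (\<lambda>n. Suc (p n))"
  using ispoly_add[OF ispoly_const[of 1]] by fastforce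

lemma ispoly_power: "ispoly (\<lambda>n. n ^ k)"
  by (induction k) (auto intro: ispoly.intros)

lemma ispoly_mono: "ispoly p \<Longrightarrow> m \<le> n \<Longrightarrow> p m \<le> p n"
  by (induction arbitrary: m n rule: ispoly.induct) (auto intro!: add_mono mult_mono)

text \<open>Time bounds arise by sums, products and substitution, which the monotone functions in
  \<open>ispoly\<close> admit directly; only here are they brought into the shape
  \<open>c * n ^ k + c\<close>.\<close>

lemma ispoly_bounded: "ispoly p \<Longrightarrow> \<exists>c k. \<forall>n. p n \<le> c * n ^ k + c"
proof (induction rule: ispoly.induct)
  case ispoly_id
  show ?case by (intro exI[of _ 1] exI[of _ 1]) auto
next
  case (ispoly_const c)
  show ?case by (intro exI[of _ c] exI[of _ 0]) auto
next
  case (ispoly_add p q)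
  then obtain c k c' k' where
    p: "\<And>n. p n \<le> c * n ^ k + c" and q: "\<And>n. q n \<le> c' * n ^ k' + c'" by blast
  \<comment> \<open>The summand 1 covers \<open>n = 0\<close> with \<open>i = 0\<close>; the larger
    coefficients below absorb it.\<close>
  have pow: "n ^ i \<le> n ^ (k + k') + 1" if "i \<le> k + k'" for n i :: nat
    using power_increasing[OF that, of n] by (cases "n = 0") (auto simp: power_0_left)
  have "p n + q n \<le> (2 * c + 2 * c') * n ^ (k + k') + (2 * c + 2 * c')" for n
  proof -
    have "c * n ^ k \<le> c * (n ^ (k + k') + 1)" "c' * n ^ k' \<le> c' * (n ^ (k + k') + 1)"
      by (intro mult_left_mono pow; simp)+
    then show ?thesis using p[of n] q[of n] by (simp add: algebra_simps)
  qed
  then show ?case by blast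
next
  case (ispoly_mult p q)
  then obtain c k c' k' where
    p: "\<And>n. p n \<le> c * n ^ k + c" and q: "\<And>n. q n \<le> c' * n ^ k' + c'" by blast
  have pow: "n ^ i \<le> n ^ (k + k') + 1" if "i \<le> k + k'" for n i :: nat
    using power_increasing[OF that, of n] by (cases "n = 0") (auto simp: power_0_left)
  have "p n * q n \<le> (4 * c * c') * n ^ (k + k') + (4 * c * c')" for n
  proof -
    have "p n * q n \<le> (c * n ^ k + c) * (c' * n ^ k' + c')" by (intro mult_mono p q) auto
    also have "\<dots> = c * c' * n ^ (k + k') + c * c' * n ^ k + c * c' * n ^ k' + c * c'"
      by (simp add: algebra_simps power_add)
    also have "\<dots> \<le> c * c' * n ^ (k + k') + c * c' * (n ^ (k + k') + 1)
        + c * c' * (n ^ (k + k') + 1) + c * c'"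
      by (intro add_mono mult_left_mono pow) auto
    also have "\<dots> \<le> (4 * c * c') * n ^ (k + k') + (4 * c * c')" by (simp add: algebra_simps)
    finally show ?thesis .
  qed
  then show ?case by blast
qed

lemma polytimeI:
  assumes "ispoly p" and "\<And>x. \<exists>t. runs P x t (F x) \<and> t \<le> p (size x)"
  shows "polytime F"
proof -
  from ispoly_bounded[OF assms(1)] obtain c k where "\<And>n. p n \<le> c * n ^ k + c" by blast
  then show ?thesis
    unfolding polytime_def using assms(2)
    by (intro exI[of _ P] exI[of _ c] exI[of _ k]) (meson order_trans)
qed

lemma polytimeE:
  assumes "polytime F"
  obtains P p where "ispoly p" and "\<And>x. \<exists>t. runs P x t (F x) \<and> t \<le> p (size x)"
proof -
  from assms obtain P c k where *: "\<And>x. \<exists>t. runs P x t (F x) \<and> t \<le> c * size x ^ k + c"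
    unfolding polytime_def by blast
  show thesis
    by (rule that[OF _ *]) (intro ispoly.intros ispoly_power)
qed

lemma polytime_size:
  assumes "polytime F"
  obtains p where "ispoly p" and "\<And>x. size (F x) \<le> p (size x)"
  using assms by (elim polytimeE) (meson le_trans runs_size)

primrec dfst :: "data \<Rightarrow> data" where
  "dfst Leaf = Leaf"
| "dfst (Node x y) = x"

primrec dsnd :: "data \<Rightarrow> data" where
  "dsnd Leaf = Leaf"
| "dsnd (Node x y) = y"

lemma size_dfst: "size (dfst d) \<le> size d" and size_dsnd: "size (dsnd d) \<le> size d"
  by (cases d; simp)+

lemma polytime_id: "polytime (\<lambda>x. x)"
  by (rule polytimeI[of "\<lambda>n. Suc n" PId]) (intro ispoly_Suc ispoly_id, blast intro: runs.intros(1))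

lemma polytime_Leaf: "polytime (\<lambda>x. Leaf)"
  by (rule polytimeI[of "\<lambda>n. Suc n" PLeaf]) (intro ispoly_Suc ispoly_id, blast intro: runs.intros(2))

lemma polytime_comp:
  assumes "polytime F" "polytime G"
  shows "polytime (\<lambda>x. F (G x))"
proof -
  obtain P p where p: "ispoly p" "\<And>x. \<exists>t. runs P x t (F x) \<and> t \<le> p (size x)"
    by (rule polytimeE[OF assms(1)]) (rule that)
  obtain Q q where q: "ispoly q" "\<And>x. \<exists>t. runs Q x t (G x) \<and> t \<le> q (size x)"
    by (rule polytimeE[OF assms(2)]) (rule that)
  show ?thesis
  proof (rule polytimeI[of "\<lambda>n. Suc (q n + p (q n))" "PComp Q P"])
    fix x
    obtain t u where t: "runs Q x t (G x)" "t \<le> q (size x)"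
      and u: "runs P (G x) u (F (G x))" "u \<le> p (size (G x))" using p(2)[of "G x"] q(2)[of x] by blast
    moreover have "p (size (G x)) \<le> p (q (size x))"
      using runs_size[OF t(1)] t(2) by (intro ispoly_mono[OF p(1)]) auto
    ultimately show "\<exists>t. runs (PComp Q P) x t (F (G x)) \<and> t \<le> Suc (q (size x) + p (q (size x)))"
      using runs.intros(10)[OF t(1) u(1)] t(2) u(2)
      by (intro exI[of _ "Suc (t + u)"]) simp
  qed (intro ispoly_Suc ispoly.intros ispoly_comp[OF p(1)] q)
qed

lemma polytime_Node:
  assumes "polytime F" "polytime G"
  shows "polytime (\<lambda>x. Node (F x) (G x))"
proof -
  obtain P p where p: "ispoly p" "\<And>x. \<exists>t. runs P x t (F x) \<and> t \<le> p (size x)"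
    by (rule polytimeE[OF assms(1)]) (rule that)
  obtain Q q where q: "ispoly q" "\<And>x. \<exists>t. runs Q x t (G x) \<and> t \<le> q (size x)"
    by (rule polytimeE[OF assms(2)]) (rule that)
  show ?thesis
  proof (rule polytimeI[of "\<lambda>n. Suc (p n + q n)" "PPair P Q"])
    fix x
    obtain t u where t: "runs P x t (F x)" "t \<le> p (size x)"
      and u: "runs Q x u (G x)" "u \<le> q (size x)" using p(2)[of x] q(2)[of x] by blast
    then show "\<exists>t. runs (PPair P Q) x t (Node (F x) (G x)) \<and> t \<le> Suc (p (size x) + q (size x))"
      using runs.intros(9)[OF t(1) u(1)]
      by (intro exI[of _ "Suc (t + u)"]) simp
  qed (intro ispoly_Suc ispoly.intros p q)
qed

lemma polytime_const: "polytime (\<lambda>x. d)"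
  by (induction d) (simp_all add: polytime_Leaf polytime_Node)

lemma polytime_dfst: "polytime F \<Longrightarrow> polytime (\<lambda>x. dfst (F x))"
proof (rule polytime_comp[of dfst])
  show "polytime dfst"
  proof (rule polytimeI[of "\<lambda>n. Suc n" PFst])
    show "\<exists>t. runs PFst x t (dfst x) \<and> t \<le> Suc (size x)" for x
      by (cases x) (use runs.intros(3,4) in force)+
  qed (intro ispoly_Suc ispoly.intros)
qed

lemma polytime_dsnd: "polytime F \<Longrightarrow> polytime (\<lambda>x. dsnd (F x))"
proof (rule polytime_comp[of dsnd])
  show "polytime dsnd"
  proof (rule polytimeI[of "\<lambda>n. Suc n" PSnd])
    show "\<exists>t. runs PSnd x t (dsnd x) \<and> t \<le> Suc (size x)" for x
      by (cases x) (use runs.intros(5,6) in force)+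
  qed (intro ispoly_Suc ispoly.intros)
qed

lemma polytime_eq:
  assumes "polytime F" "polytime G"
  shows "polytime (\<lambda>x. if F x = G x then Node Leaf Leaf else Leaf)"
proof -
  let ?e = "\<lambda>d. case d of Leaf \<Rightarrow> Leaf | Node x y \<Rightarrow> if x = y then Node Leaf Leaf else Leaf"
  have "polytime ?e"
  proof (rule polytimeI[of "\<lambda>n. Suc n" PEq])
    show "\<exists>t. runs PEq x t (?e x) \<and> t \<le> Suc (size x)" for x
    proof (cases x)
      case Leaf
      then show ?thesis using runs.intros(7) by force
    next
      case (Node y z)
      then show ?thesis using runs.intros(8)[of y z] by (intro exI[of _ "Suc (size x)"]) simp
    qed
  qed (intro ispoly_Suc ispoly.intros)
  from polytime_comp[OF this polytime_Node[OF assms]] show ?thesis by simp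
qed

lemma polytime_if:
  assumes "polytime C" "polytime F" "polytime G"
  shows "polytime (\<lambda>x. if C x \<noteq> Leaf then F x else G x)"
proof -
  obtain P p where p: "ispoly p" "\<And>x. \<exists>t. runs P x t (F x) \<and> t \<le> p (size x)"
    by (rule polytimeE[OF assms(2)]) (rule that)
  obtain Q q where q: "ispoly q" "\<And>x. \<exists>t. runs Q x t (G x) \<and> t \<le> q (size x)"
    by (rule polytimeE[OF assms(3)]) (rule that)
  obtain R r where r: "ispoly r" "\<And>x. \<exists>t. runs R x t (C x) \<and> t \<le> r (size x)"
    by (rule polytimeE[OF assms(1)]) (rule that)
  show ?thesis
  proof (rule polytimeI[of "\<lambda>n. Suc (r n + (p n + q n))" "PIf R P Q"])
    fix x
    obtain t u v where t: "runs P x t (F x)" "t \<le> p (size x)"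
      and u: "runs Q x u (G x)" "u \<le> q (size x)"
      and v: "runs R x v (C x)" "v \<le> r (size x)" using p(2)[of x] q(2)[of x] r(2)[of x] by blast
    show "\<exists>t. runs (PIf R P Q) x t (if C x \<noteq> Leaf then F x else G x)
        \<and> t \<le> Suc (r (size x) + (p (size x) + q (size x)))"
    proof (cases "C x = Leaf")
      case True
      with t u v runs.intros(12)[of R x v Q u "G x" P] show ?thesis
        by (intro exI[of _ "Suc (v + u)"]) simp
    next
      case False
      with t u v runs.intros(11)[of R x v "C x" P t "F x" Q] show ?thesis
        by (intro exI[of _ "Suc (v + t)"]) simp
    qed
  qed (intro ispoly_Suc ispoly.intros p q r)
qed

lemma polytime_if_eq:
  assumes "polytime A" "polytime B" "polytime F" "polytime G"
  shows "polytime (\<lambda>x. if A x = B x then F x else G x)"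
  using polytime_if[OF polytime_eq[OF assms(1,2)] assms(3,4)]
  by (rule back_subst[of polytime]) auto

text \<open>\<open>\<mu>\<close> bounds the number of rounds; \<open>I\<close> relates the start
  state to every later one and so bounds its size. The time is the number of rounds, plus one for
  the last test, times the cost of a round on the largest state.\<close>

lemma polytime_while:
  assumes c: "polytime c" and f: "polytime f" and q: "ispoly q"
    and dec: "\<And>x. c x \<noteq> Leaf \<Longrightarrow> \<mu> (f x) < \<mu> x" and \<mu>: "\<And>x. \<mu> x \<le> q (size x)"
    and I0: "\<And>x. I x x" and I: "\<And>x y. I x y \<Longrightarrow> c y \<noteq> Leaf \<Longrightarrow> I x (f y)"
    and size: "\<And>x y. I x y \<Longrightarrow> size y \<le> q (size x)"
  shows "polytime (while (\<lambda>x. c x \<noteq> Leaf) f)"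
proof -
  obtain C r where r: "ispoly r" "\<And>x. \<exists>t. runs C x t (c x) \<and> t \<le> r (size x)"
    by (rule polytimeE[OF c]) (rule that)
  obtain F p where p: "ispoly p" "\<And>x. \<exists>t. runs F x t (f x) \<and> t \<le> p (size x)"
    by (rule polytimeE[OF f]) (rule that)
  let ?w = "while (\<lambda>x. c x \<noteq> Leaf) f"
  let ?b = "\<lambda>n. Suc (r (q n) + p (q n))"
  have *: "\<exists>t. runs (PWhile C F) y t (?w y) \<and> t \<le> Suc (\<mu> y) * ?b (size x)" if "I x y" for x y
    using that
  proof (induction "\<mu> y" arbitrary: y rule: less_induct)
    case less
    have mono: "r (size y) \<le> r (q (size x))" "p (size y) \<le> p (q (size x))"
      using size[OF less.prems] by (rule ispoly_mono[OF r(1)], rule ispoly_mono[OF p(1)])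
    obtain t where t: "runs C y t (c y)" "t \<le> r (size y)" using r(2)[of y] by blast
    show ?case
    proof (cases "c y = Leaf")
      case True
      then have "runs (PWhile C F) y (Suc t) (?w y)"
        using t runs.intros(13)[of C y t F] by (subst while_unfold) simp
      moreover have "Suc t \<le> Suc (\<mu> y) * ?b (size x)" using t mono by simp
      ultimately show ?thesis by blast
    next
      case False
      obtain u where u: "runs F y u (f y)" "u \<le> p (size y)" using p(2)[of y] by blast
      obtain v where v: "runs (PWhile C F) (f y) v (?w (f y))" "v \<le> Suc (\<mu> (f y)) * ?b (size x)"
        using less.hyps[OF dec[OF False] I[OF less.prems False]] by blast
      have "runs (PWhile C F) y (Suc (t + u + v)) (?w y)"
        using runs.intros(14)[OF t(1) False u(1) v(1)] False by (subst while_unfold) simp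
      moreover have "Suc (t + u + v) \<le> ?b (size x) + \<mu> y * ?b (size x)"
      proof -
        have "Suc (t + u) \<le> ?b (size x)" using t u mono by simp
        moreover have "v \<le> \<mu> y * ?b (size x)"
          using v(2) dec[OF False] by (meson Suc_leI le_trans mult_le_mono1)
        ultimately show ?thesis by simp
      qed
      ultimately show ?thesis by (metis mult_Suc)
    qed
  qed
  show ?thesis
  proof (rule polytimeI[of "\<lambda>n. Suc (q n) * ?b n" "PWhile C F"])
    show "\<exists>t. runs (PWhile C F) x t (?w x) \<and> t \<le> Suc (q (size x)) * ?b (size x)" for x
    proof -
      obtain t where t: "runs (PWhile C F) x t (?w x)" "t \<le> Suc (\<mu> x) * ?b (size x)"
        using *[OF I0] by blast
      have "Suc (\<mu> x) * ?b (size x) \<le> Suc (q (size x)) * ?b (size x)"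
        using \<mu> by (intro mult_le_mono1) simp
      with t show ?thesis by (meson le_trans)
    qed
  qed (intro ispoly_Suc ispoly.intros ispoly_comp[OF r(1)] ispoly_comp[OF p(1)] q)
qed

section \<open>Lists as right-nested nodes, and loops over them\<close>

primrec dl :: "data \<Rightarrow> data list" where
  "dl Leaf = []"
| "dl (Node x y) = x # dl y"

lemma dl_enc_list [simp]: "dl (enc_list xs) = xs"
  by (induction xs) auto

lemma enc_list_dl [simp]: "enc_list (dl d) = d"
  by (induction d) auto

lemma size_enc_list: "size (enc_list xs) = (\<Sum>x\<leftarrow>xs. Suc (size x))"
  by (induction xs) auto

lemma size_enc_list_append: "size (enc_list (xs @ ys)) = size (enc_list xs) + size (enc_list ys)"
  by (simp add: size_enc_list)

text \<open>A polynomial-time step is not enough, since its iteration may double the state in every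
  round; hence the bound \<open>q\<close>. Being assumed for all lists, it also applies to every
  prefix already consumed.\<close>

lemma polytime_fold:
  assumes f: "polytime (\<lambda>d. f (dfst d) (dsnd d))" and q: "ispoly q"
    and size: "\<And>xs s. size (fold f xs s) \<le> q (size (enc_list xs) + size s)"
  shows "polytime (\<lambda>d. fold f (dl (dfst d)) (dsnd d))"
proof -
  let ?step = "\<lambda>d. Node (dsnd (dfst d)) (f (dfst (dfst d)) (dsnd d))"
  let ?w = "while (\<lambda>d. dfst d \<noteq> Leaf) ?step"
  let ?I = "\<lambda>d e. \<exists>us. dl (dfst d) = us @ dl (dfst e) \<and> dsnd e = fold f us (dsnd d)"
  have "polytime ?w"
  proof (rule polytime_while[where q = "\<lambda>n. Suc (n + q n)" and \<mu> = "\<lambda>d. size (dfst d)" and I = ?I])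
    show "polytime ?step"
    proof -
      have "polytime (\<lambda>d. Node (dfst (dfst d)) (dsnd d))"
        by (intro polytime_Node polytime_dfst polytime_dsnd polytime_id)
      from polytime_comp[OF f this] have "polytime (\<lambda>d. f (dfst (dfst d)) (dsnd d))" by simp
      then show ?thesis by (intro polytime_Node polytime_dfst polytime_dsnd polytime_id)
    qed
    show "size (dfst (?step d)) < size (dfst d)" if "dfst d \<noteq> Leaf" for d
      using that by (cases "dfst d") auto
    show "size (dfst d) \<le> Suc (size d + q (size d))" for d using size_dfst[of d] by simp
    show "?I d d" for d by (intro exI[of _ "[]"]) auto
    show "?I d (?step e)" if "?I d e" "dfst e \<noteq> Leaf" for d e
    proof -
      from that(1) obtain us where "dl (dfst d) = us @ dl (dfst e)" "dsnd e = fold f us (dsnd d)"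
        by blast
      with that(2) show ?thesis
        by (intro exI[of _ "us @ [dfst (dfst e)]"]) (cases "dfst e"; simp)
    qed
    show "size e \<le> Suc (size d + q (size d))" if I: "?I d e" for d e
    proof -
      obtain us where us: "dl (dfst d) = us @ dl (dfst e)" "dsnd e = fold f us (dsnd d)"
        using I by blast
      have "size (dfst d) = size (enc_list us) + size (dfst e)"
        by (metis us(1) enc_list_dl size_enc_list_append)
      then have e1: "size (enc_list us) + size (dfst e) \<le> size (dfst d)" by simp
      have d: "size (dfst d) + size (dsnd d) \<le> size d" by (cases d) auto
      have "size (dsnd e) \<le> q (size (enc_list us) + size (dsnd d))" using size us by simp
      also have "\<dots> \<le> q (size d)" using e1 d by (intro ispoly_mono[OF q]) simp
      finally show ?thesis using e1 d by (cases e) auto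
    qed
  qed (auto intro!: polytime_id polytime_dfst ispoly_Suc ispoly.intros q)
  moreover have "?w (Node (enc_list xs) s) = Node Leaf (fold f xs s)" for xs s
    by (induction xs arbitrary: s) (subst while_unfold; simp)+
  then have "dsnd (?w (Node (dfst d) (dsnd d))) = fold f (dl (dfst d)) (dsnd d)" for d
    by (metis dsnd.simps(2) enc_list_dl)
  ultimately show ?thesis
    using polytime_dsnd[OF polytime_comp[of ?w "\<lambda>d. Node (dfst d) (dsnd d)"]]
    by (simp add: polytime_Node polytime_dfst polytime_dsnd polytime_id)
qed

text \<open>Growth charged to the consumed element adds up to growth linear in the code of the
  list.\<close>

lemma polytime_fold_additive:
  assumes f: "polytime (\<lambda>d. f (dfst d) (dsnd d))"
    and size: "\<And>x s. size (f x s) \<le> size s + c * Suc (size x)"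
  shows "polytime (\<lambda>d. fold f (dl (dfst d)) (dsnd d))"
proof (rule polytime_fold[OF f, of "\<lambda>n. n + c * n"])
  have "size (fold f xs s) \<le> size s + c * size (enc_list xs)" for xs s
  proof (induction xs arbitrary: s)
    case (Cons x xs)
    have "size (fold f (x # xs) s) \<le> size (f x s) + c * size (enc_list xs)"
      using Cons.IH by simp
    also have "\<dots> \<le> size s + c * Suc (size x) + c * size (enc_list xs)" using size by simp
    finally show ?case by (simp add: algebra_simps)
  qed auto
  then show "size (fold f xs s) \<le> size (enc_list xs) + size s + c * (size (enc_list xs) + size s)"
    for xs s
    by (rule order_trans) (simp add: algebra_simps)
qed (intro ispoly.intros)

text \<open>Moving elements one by one onto an accumulator is what a loop does naturally; reversal
  takes one such pass and append takes two.\<close>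

definition drevapp :: "data \<Rightarrow> data \<Rightarrow> data" where
  "drevapp x y = enc_list (rev (dl x) @ dl y)"

lemma size_drevapp: "size (drevapp x y) = size x + size y"
proof -
  have "size (enc_list (rev xs)) = size (enc_list xs)" for xs
    by (induction xs) (auto simp: size_enc_list_append)
  then show ?thesis by (simp add: drevapp_def size_enc_list_append)
qed

lemma polytime_drevapp:
  assumes "polytime F" "polytime G"
  shows "polytime (\<lambda>x. drevapp (F x) (G x))"
proof -
  have "polytime (\<lambda>d. fold Node (dl (dfst d)) (dsnd d))"
    by (rule polytime_fold_additive[where c = 1])
      (auto intro!: polytime_Node polytime_dfst polytime_dsnd polytime_id)
  moreover have "fold Node xs s = enc_list (rev xs @ dl s)" for xs s
    by (induction xs arbitrary: s) auto
  ultimately have "polytime (\<lambda>d. drevapp (dfst d) (dsnd d))" by (simp add: drevapp_def)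
  from polytime_comp[OF this polytime_Node[OF assms]] show ?thesis by simp
qed

lemma polytime_append:
  assumes "polytime F" "polytime G"
  shows "polytime (\<lambda>x. enc_list (dl (F x) @ dl (G x)))"
proof -
  have "polytime (\<lambda>x. drevapp (drevapp (F x) Leaf) (G x))"
    by (intro polytime_drevapp assms polytime_Leaf)
  then show ?thesis by (simp add: drevapp_def)
qed

text \<open>\<open>F\<close> sees the fixed parameter \<open>dfst d\<close> and one element, never
  the accumulator. So each piece of the output is polynomial in the input, and no size hypothesis
  arises.\<close>

lemma polytime_concat_map:
  assumes F: "polytime F"
  shows "polytime (\<lambda>d. enc_list (concat (map (\<lambda>x. dl (F (Node (dfst d) x))) (dl (dsnd d)))))"
proof -
  obtain r where r: "ispoly r" "\<And>x. size (F x) \<le> r (size x)" using polytime_size[OF F] by blast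
  let ?f = "\<lambda>x s. Node (dfst s) (drevapp (F (Node (dfst s) x)) (dsnd s))"
  \<comment> \<open>\<open>N\<close> stays fixed while the list shrinks, so that \<open>r\<close>
    keeps one argument throughout the induction.\<close>
  have sz: "size (fold ?f xs s) \<le> Suc (size (dfst s) + size (dsnd s)
      + size (enc_list xs) * r (Suc (size (dfst s) + N)))" if "size (enc_list xs) \<le> N" for xs s N
    using that
  proof (induction xs arbitrary: s)
    case Nil
    show ?case by (cases s) auto
  next
    case (Cons x xs)
    have "size (F (Node (dfst s) x)) \<le> r (Suc (size (dfst s) + N))"
      using r(2)[of "Node (dfst s) x"] Cons.prems
      by (elim order_trans) (rule ispoly_mono[OF r(1)], simp)
    then show ?case
      using Cons.IH[of "?f x s"] Cons.prems by (simp add: size_drevapp algebra_simps)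
  qed
  have "polytime (\<lambda>d. fold ?f (dl (dfst d)) (dsnd d))"
  proof (rule polytime_fold[where q = "\<lambda>n. Suc (n + n * r (Suc n))"])
    have F': "polytime (\<lambda>d. F (Node (dfst (dsnd d)) (dfst d)))"
      by (intro polytime_comp[OF F] polytime_Node polytime_dfst polytime_dsnd polytime_id)
    show "polytime (\<lambda>d. ?f (dfst d) (dsnd d))"
      by (intro F' polytime_drevapp polytime_Node polytime_dfst polytime_dsnd polytime_id)
    show "size (fold ?f xs s) \<le> Suc (size (enc_list xs) + size s
        + (size (enc_list xs) + size s) * r (Suc (size (enc_list xs) + size s)))" for xs s
    proof -
      have "size (dfst s) + size (dsnd s) \<le> size s" by (cases s) auto
      moreover from this have "r (Suc (size (dfst s) + size (enc_list xs)))
          \<le> r (Suc (size (enc_list xs) + size s))"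
        by (intro ispoly_mono[OF r(1)]) simp
      then have "size (enc_list xs) * r (Suc (size (dfst s) + size (enc_list xs)))
          \<le> (size (enc_list xs) + size s) * r (Suc (size (enc_list xs) + size s))"
        by (intro mult_le_mono) auto
      ultimately show ?thesis using sz[of xs "size (enc_list xs)" s] by linarith
    qed
  qed (intro ispoly_Suc ispoly.intros ispoly_comp[OF r(1)])
  from polytime_comp[OF this, of "\<lambda>d. Node (dsnd d) (Node (dfst d) Leaf)"]
  have "polytime (\<lambda>d. fold ?f (dl (dsnd d)) (Node (dfst d) Leaf))"
    by (simp add: polytime_Node polytime_dfst polytime_dsnd polytime_id polytime_Leaf)
  then have "polytime (\<lambda>d. drevapp (dsnd (fold ?f (dl (dsnd d)) (Node (dfst d) Leaf))) Leaf)"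
    by (intro polytime_drevapp polytime_dsnd polytime_Leaf)
  moreover have "fold ?f xs (Node p acc)
      = Node p (enc_list (rev (concat (map (\<lambda>x. dl (F (Node p x))) xs)) @ dl acc))" for xs p acc
    by (induction xs arbitrary: acc) (auto simp: drevapp_def)
  ultimately show ?thesis by (simp add: drevapp_def)
qed

section \<open>One-sided sequents\<close>

text \<open>An item \<open>(s, d, ls)\<close> is the disjunction (\<open>d\<close>) or conjunction (\<open>\<not> d\<close>) of the literals \<open>ls\<close>,
  standing on the right (\<open>s\<close>) or on the left (\<open>\<not> s\<close>) of a sequent. Conjunctions on the left
  behave like disjunctions on the right, so the two sides can be treated together.\<close>

type_synonym item = "bool \<times> bool \<times> lit list"

abbreviation side :: "item \<Rightarrow> bool" where "side x \<equiv> fst x"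
abbreviation disj :: "item \<Rightarrow> bool" where "disj x \<equiv> fst (snd x)"
abbreviation lits :: "item \<Rightarrow> lit list" where "lits x \<equiv> snd (snd x)"

text \<open>\<open>conv\<close> agrees with \<open>Disj\<close> and \<open>Conj\<close> on nonempty lists; unlike them it has a known value on
  \<open>[]\<close>, so that a program can compute it on all inputs.\<close>

definition conv :: "bool \<Rightarrow> lit list \<Rightarrow> dt" where
  "conv d ls = (case rev ls of [] \<Rightarrow> DLit (Pos 0) | p # ps \<Rightarrow>
     fold (\<lambda>q A. if d then Dec A q (DLit q) else Dec (DLit q) q A) ps (DLit p))"

definition form :: "item \<Rightarrow> dt" where
  "form x = conv (disj x) (lits x)"

definition toseq :: "item list \<Rightarrow> dt lsequent" where
  "toseq \<Omega> = (map form (filter (\<lambda>x. \<not> side x) \<Omega>), map form (filter side \<Omega>))"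

definition sq :: "item list \<Rightarrow> dt sequent" where
  "sq \<Omega> = seq_of (toseq \<Omega>)"

definition neg_item :: "item \<Rightarrow> item" where
  "neg_item x = (\<not> side x, snd x)"

text \<open>The flag is a convention: a single literal is both a conjunction and a disjunction, and
  \<open>form\<close> agrees on the two.\<close>

definition lit_item :: "bool \<Rightarrow> lit \<Rightarrow> item" where
  "lit_item s p = (s, False, [p])"

lemma conv_single [simp]: "conv d [p] = DLit p"
  by (simp add: conv_def)

lemma conv_Cons:
  assumes "ps \<noteq> []"
  shows "conv d (p # ps) = (if d then Dec (conv d ps) p (DLit p) else Dec (DLit p) p (conv d ps))"
proof -
  obtain q qs where "rev ps = q # qs" using assms by (cases "rev ps") auto
  then show ?thesis by (simp add: conv_def)
qed

lemma conv_Disj: "ls \<noteq> [] \<Longrightarrow> conv True ls = Disj ls"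
  by (induction ls rule: Disj.induct) (auto simp: conv_Cons)

lemma conv_Conj: "ls \<noteq> [] \<Longrightarrow> conv False ls = Conj ls"
  by (induction ls rule: Conj.induct) (auto simp: conv_Cons)

lemma sq_eq: "sq \<Omega> = (image_mset form (filter_mset (\<lambda>x. \<not> side x) (mset \<Omega>)),
    image_mset form (filter_mset side (mset \<Omega>)))"
  by (simp add: sq_def toseq_def seq_of_def mset_filter)

lemma sq_cong: "mset \<Omega> = mset \<Omega>' \<Longrightarrow> sq \<Omega> = sq \<Omega>'"
  by (simp add: sq_eq)

lemma sq_Nil: "sq [] = ({#}, {#})"
  by (simp add: sq_eq)

lemma sq_Cons: "sq (x # \<Omega>) = (if side x then (fst (sq \<Omega>), add_mset (form x) (snd (sq \<Omega>)))
    else (add_mset (form x) (fst (sq \<Omega>)), snd (sq \<Omega>)))"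
  by (simp add: sq_eq)

lemma form_lit [simp]: "form (lit_item s p) = DLit p" "form (s, d, [p]) = DLit p"
  by (simp_all add: form_def lit_item_def)

lemma side_lit [simp]: "side (lit_item s p) = s"
  by (simp add: lit_item_def)

lemma neg_item_simps [simp]: "side (neg_item x) = (\<not> side x)" "disj (neg_item x) = disj x"
  "lits (neg_item x) = lits x" "form (neg_item x) = form x"
  by (simp_all add: neg_item_def form_def)

section \<open>Derivations as programs for a stack machine\<close>

text \<open>Each instruction names the sequent derived from the topmost sequents of the stack;
  \<open>Binary b\<close> says whether the top of the stack is the first premise. \<open>Nip\<close> drops the second
  sequent of the stack. The sequents of the other instructions are the lines of a dag-like
  derivation; executed on a stack of trees, a program builds tree-like derivations.\<close>

datatype instr = Push | Unary | Binary bool | Nip | Swap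

type_synonym code = "(instr \<times> item list) list"

inductive run :: "code \<Rightarrow> dt sequent list \<Rightarrow> dt sequent list \<Rightarrow> bool" where
  run_Nil: "run [] st st"
| run_Push: "ldt_inf [] (sq \<Omega>) \<Longrightarrow> run c (sq \<Omega> # st) st' \<Longrightarrow> run ((Push, \<Omega>) # c) st st'"
| run_Unary: "ldt_inf [S] (sq \<Omega>) \<Longrightarrow> run c (sq \<Omega> # st) st' \<Longrightarrow> run ((Unary, \<Omega>) # c) (S # st) st'"
| run_Binary: "ldt_inf (if b then [S, S'] else [S', S]) (sq \<Omega>) \<Longrightarrow> run c (sq \<Omega> # st) st'
    \<Longrightarrow> run ((Binary b, \<Omega>) # c) (S # S' # st) st'"
| run_Nip: "run c (S # st) st' \<Longrightarrow> run ((Nip, \<Omega>) # c) (S # S' # st) st'"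
| run_Swap: "run c (S' # S # st) st' \<Longrightarrow> run ((Swap, \<Omega>) # c) (S # S' # st) st'"

lemma run_append: "run c st st' \<Longrightarrow> run c' st' st'' \<Longrightarrow> run (c @ c') st st''"
  by (induction rule: run.induct) (auto intro: run.intros)

lemma ldt_weak: "mset \<Omega>' = add_mset x (mset \<Omega>) \<Longrightarrow> ldt_inf [sq \<Omega>] (sq \<Omega>')"
  using common_inf.weak_l[of DLit "fst (sq \<Omega>)" "snd (sq \<Omega>)" "form x"]
    common_inf.weak_r[of DLit "fst (sq \<Omega>)" "snd (sq \<Omega>)" "form x"]
  by (auto simp: sq_eq intro!: ldt_inf.common)

lemma ldt_contr:
  assumes "mset \<Omega> = add_mset x (mset \<Omega>')" "x \<in> set \<Omega>'"
  shows "ldt_inf [sq \<Omega>] (sq \<Omega>')"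
proof -
  obtain M where M: "mset \<Omega>' = add_mset x M" using assms(2) by (metis mset_add set_mset_mset)
  show ?thesis
    using assms(1) M common_inf.contr_l[of DLit "form x"] common_inf.contr_r[of DLit _ "form x"]
    by (cases "side x") (auto simp: sq_eq intro!: ldt_inf.common)
qed

lemma run_weak: "mset \<Omega>' = add_mset x (mset \<Omega>) \<Longrightarrow> run c (sq \<Omega>' # st) st' \<Longrightarrow>
    run ((Unary, \<Omega>') # c) (sq \<Omega> # st) st'"
  by (intro run_Unary ldt_weak)

lemma run_contr: "mset \<Omega> = add_mset x (mset \<Omega>') \<Longrightarrow> x \<in> set \<Omega>' \<Longrightarrow> run c (sq \<Omega>' # st) st' \<Longrightarrow>
    run ((Unary, \<Omega>') # c) (sq \<Omega> # st) st'"
  by (intro run_Unary ldt_contr)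

text \<open>The first premise of a cut has the cut formula on the right. On top of the stack lies
  the sequent with \<open>neg_item x\<close>, which is that premise exactly if \<open>x\<close> is
  on the left.\<close>

definition cutc :: "item \<Rightarrow> item list \<Rightarrow> code" where
  "cutc x \<Omega> = [(Binary (\<not> side x), \<Omega>)]"

lemma run_cut: "run (cutc x \<Omega>) (sq (neg_item x # \<Omega>) # sq (x # \<Omega>) # st) (sq \<Omega> # st)"
  using common_inf.cut[of DLit "fst (sq \<Omega>)" "form x" "snd (sq \<Omega>)"]
  by (auto simp: cutc_def sq_Cons intro!: run_Binary run_Nil ldt_inf.common)

lemma ldt_init: "ldt_inf [] (sq [(s, d, [p]), (\<not> s, d', [p])])"
  using common_inf.init[of DLit p] by (auto simp: sq_Cons sq_Nil intro!: ldt_inf.common)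

text \<open>Since one branch of the decision is \<open>p\<close> itself, one premise has
  \<open>p\<close> on both sides and is an axiom up to weakening. The other has \<open>p\<close> and
  the rest on the same side, so the rule acts as an unbranched one. The side determines which
  premise comes first.\<close>

lemma ldt_alpha:
  assumes "ps \<noteq> []"
  shows "ldt_inf (if \<not> s then [sq (lit_item s p # lit_item (\<not> s) p # \<Omega>), sq (lit_item s p # (s, s, ps) # \<Omega>)]
      else [sq (lit_item s p # (s, s, ps) # \<Omega>), sq (lit_item s p # lit_item (\<not> s) p # \<Omega>)])
    (sq ((s, s, p # ps) # \<Omega>))"
  using assms ldt_inf.dec_l[of "DLit p" "fst (sq \<Omega>)" p "snd (sq \<Omega>)" "conv False ps"]
    ldt_inf.dec_r[of "fst (sq \<Omega>)" "conv True ps" p "snd (sq \<Omega>)" "DLit p"]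
  by (cases s) (auto simp: sq_Cons form_def conv_Cons lit_item_def add_mset_commute)

text \<open>Here the branch \<open>p\<close> duplicates the decided literal in one premise, while
  the other premise has the rest together with \<open>p\<close> on the opposite side.\<close>

lemma ldt_beta:
  assumes "ps \<noteq> []"
  shows "ldt_inf (if s then [sq (lit_item s p # lit_item s p # \<Omega>), sq (lit_item (\<not> s) p # (s, \<not> s, ps) # \<Omega>)]
      else [sq (lit_item (\<not> s) p # (s, \<not> s, ps) # \<Omega>), sq (lit_item s p # lit_item s p # \<Omega>)])
    (sq ((s, \<not> s, p # ps) # \<Omega>))"
  using assms ldt_inf.dec_l[of "conv True ps" "fst (sq \<Omega>)" p "snd (sq \<Omega>)" "DLit p"]
    ldt_inf.dec_r[of "fst (sq \<Omega>)" "DLit p" p "snd (sq \<Omega>)" "conv False ps"]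
  by (cases s) (auto simp: sq_Cons form_def conv_Cons lit_item_def add_mset_commute)

text \<open>Nonempty suffixes: a recursion on a list becomes a map over them, taken in reverse where
  the code for the tail has to come first.\<close>

primrec tails :: "'a list \<Rightarrow> 'a list list" where
  "tails [] = []"
| "tails (x # xs) = (x # xs) # tails xs"

section \<open>Sequents closed by their literals\<close>

text \<open>A left conjunction or right disjunction contributes each of its literals to its side.\<close>

definition alpha :: "item \<Rightarrow> bool" where
  "alpha x \<longleftrightarrow> side x = disj x \<or> tl (lits x) = []"

text \<open>Alpha and beta are the types of uniform notation: alpha items decompose without
  branching, beta items with branching. A single literal has both types.\<close>

definition beta :: "item \<Rightarrow> bool" where
  "beta x \<longleftrightarrow> side x \<noteq> disj x \<or> tl (lits x) = []"

definition supports :: "bool \<Rightarrow> lit \<Rightarrow> item \<Rightarrow> bool" where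
  "supports s p y \<longleftrightarrow> side y = s \<and> alpha y \<and> p \<in> set (lits y)"

definition witnesses :: "item list \<Rightarrow> item list" where
  "witnesses \<Omega> = filter (\<lambda>x. beta x \<and>
     (\<forall>p\<in>set (lits x). \<exists>y\<in>set \<Omega>. supports (\<not> side x) p y)) \<Omega>"

definition closed :: "item list \<Rightarrow> bool" where
  "closed \<Omega> \<longleftrightarrow> witnesses \<Omega> \<noteq> []"

lemma closed_iff: "closed \<Omega> \<longleftrightarrow> (\<exists>x\<in>set \<Omega>. beta x \<and>
    (\<forall>p\<in>set (lits x). \<exists>y\<in>set \<Omega>. supports (\<not> side x) p y))"
  by (auto simp: closed_def witnesses_def filter_empty_conv)

lemma closed_mono: "closed \<Omega> \<Longrightarrow> set \<Omega> \<subseteq> set \<Omega>' \<Longrightarrow> closed \<Omega>'"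
  unfolding closed_iff by blast

text \<open>Changing sides exchanges the two types and keeps the literals, so one of the two items
  is a witness supported by the other.\<close>

lemma closed_neg: "x \<in> set \<Omega> \<Longrightarrow> neg_item x \<in> set \<Omega> \<Longrightarrow> closed \<Omega>"
proof (cases "side x = disj x")
  case True
  assume "x \<in> set \<Omega>" "neg_item x \<in> set \<Omega>"
  with True show ?thesis unfolding closed_iff
    by (intro bexI[of _ "neg_item x"]) (auto simp: beta_def supports_def alpha_def)
next
  case False
  assume "x \<in> set \<Omega>" "neg_item x \<in> set \<Omega>"
  with False show ?thesis unfolding closed_iff
    by (intro bexI[of _ x] conjI ballI bexI[of _ "neg_item x"])
      (auto simp: beta_def supports_def alpha_def)
qed

definition weakc :: "item list \<Rightarrow> item list \<Rightarrow> code" where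
  "weakc \<Omega> \<Omega>' = map (\<lambda>xs. (Unary, xs @ \<Omega>')) (rev (tails \<Omega>))"

lemma run_weakc: "run (weakc \<Omega> \<Omega>') (sq \<Omega>' # st) (sq (\<Omega> @ \<Omega>') # st)"
proof (induction \<Omega>)
  case Nil
  show ?case by (simp add: weakc_def run_Nil)
next
  case (Cons x \<Omega>)
  have "run [(Unary, (x # \<Omega>) @ \<Omega>')] (sq (\<Omega> @ \<Omega>') # st) (sq ((x # \<Omega>) @ \<Omega>') # st)"
    by (rule run_weak[where x = x]) (simp_all add: run_Nil)
  from run_append[OF Cons.IH this] show ?case by (simp add: weakc_def)
qed

text \<open>One round of a construction from the shortest suffix upwards. Suffixes without
  \<open>p\<close> emit nothing; the first one that contains \<open>p\<close> has it as its head and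
  starts from an axiom, and longer ones extend the sequent already on the stack.\<close>

definition alpha_step :: "bool \<Rightarrow> bool \<Rightarrow> lit \<Rightarrow> lit list \<Rightarrow> code" where
  "alpha_step s d p ls = (case ls of [] \<Rightarrow> [] | q # ps \<Rightarrow>
     if ps = [] then if p = q then [(Push, [(s, d, [q]), lit_item (\<not> s) p])] else []
     else if p \<in> set ls then
       (if p \<in> set ps then [] else [(Push, [lit_item s q, lit_item (\<not> s) q])]) @
       [(Unary, [lit_item s q, (s, d, ps), lit_item (\<not> s) p]),
        (Push, [lit_item s q, lit_item (\<not> s) q]),
        (Unary, [lit_item s q, lit_item (\<not> s) q, lit_item (\<not> s) p]),
        (Binary (\<not> s), [(s, d, ls), lit_item (\<not> s) p])]
     else [])"

definition alpha_code :: "bool \<Rightarrow> bool \<Rightarrow> lit list \<Rightarrow> lit \<Rightarrow> code" where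
  "alpha_code s d ls p = concat (map (alpha_step s d p) (rev (tails ls)))"

lemma alpha_code_Nil: "p \<notin> set ls \<Longrightarrow> alpha_code s d ls p = []"
  by (induction ls) (auto simp: alpha_code_def alpha_step_def)

lemma run_alpha_code:
  assumes "s = d \<or> tl ls = []" "p \<in> set ls"
  shows "run (alpha_code s d ls p) st (sq [(s, d, ls), lit_item (\<not> s) p] # st)"
  using assms
proof (induction ls)
  case (Cons q ps)
  have code: "alpha_code s d (q # ps) p = alpha_code s d ps p @ alpha_step s d p (q # ps)"
    by (simp add: alpha_code_def)
  show ?case
  proof (cases "ps = []")
    case True
    then show ?thesis using Cons.prems ldt_init[of s d p False]
      by (auto simp: code alpha_code_def alpha_step_def lit_item_def intro!: run_Push run_Nil)
  next
    case False
    then have d: "d = s" using Cons.prems by simp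
    let ?A = "(if p \<in> set ps then [] else [(Push, [lit_item s q, lit_item (\<not> s) q])]) :: code"
    let ?B' = "[(Push, [lit_item s q, lit_item (\<not> s) q]),
        (Unary, [lit_item s q, lit_item (\<not> s) q, lit_item (\<not> s) p]),
        (Binary (\<not> s), [(s, d, q # ps), lit_item (\<not> s) p])] :: code"
    let ?B = "(Unary, [lit_item s q, (s, d, ps), lit_item (\<not> s) p]) # ?B'"
    let ?S = "if p \<in> set ps then [(s, d, ps), lit_item (\<not> s) p] else [lit_item s q, lit_item (\<not> s) q]"
    have "run (alpha_code s d ps p @ ?A) st (sq ?S # st)"
    proof (cases "p \<in> set ps")
      case True
      then show ?thesis using Cons d by simp
    next
      case False
      then show ?thesis using ldt_init[of s False q False]
        by (auto simp: alpha_code_Nil lit_item_def intro!: run_Push run_Nil)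
    qed
    \<comment> \<open>One item is missing in either case: the head literal if \<open>p\<close>
      occurs in the tail, otherwise the tail, as then \<open>p = q\<close>.\<close>
    moreover have "run ?B (sq ?S # st) (sq [(s, d, q # ps), lit_item (\<not> s) p] # st)"
    proof (rule run_weak[where x = "if p \<in> set ps then lit_item s q else (s, d, ps)"])
      show "mset [lit_item s q, (s, d, ps), lit_item (\<not> s) p]
          = add_mset (if p \<in> set ps then lit_item s q else (s, d, ps)) (mset ?S)"
        using Cons.prems by auto
      show "run ?B' (sq [lit_item s q, (s, d, ps), lit_item (\<not> s) p] # st)
          (sq [(s, d, q # ps), lit_item (\<not> s) p] # st)"
      proof (intro run_Push run_weak[where x = "lit_item (\<not> s) p"] run_Binary run_Nil)
        show "ldt_inf [] (sq [lit_item s q, lit_item (\<not> s) q])"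
          using ldt_init[of s False q False] by (simp add: lit_item_def)
        show "ldt_inf (if \<not> s
            then [sq [lit_item s q, lit_item (\<not> s) q, lit_item (\<not> s) p],
              sq [lit_item s q, (s, d, ps), lit_item (\<not> s) p]]
            else [sq [lit_item s q, (s, d, ps), lit_item (\<not> s) p],
              sq [lit_item s q, lit_item (\<not> s) q, lit_item (\<not> s) p]])
          (sq [(s, d, q # ps), lit_item (\<not> s) p])"
          unfolding d by (rule ldt_alpha[OF False])
      qed simp
    qed
    ultimately have "run ((alpha_code s d ps p @ ?A) @ ?B) st
        (sq [(s, d, q # ps), lit_item (\<not> s) p] # st)" by (rule run_append)
    moreover have "alpha_step s d p (q # ps) = ?A @ ?B"
      using False Cons.prems by (auto simp: alpha_step_def)
    ultimately show ?thesis by (simp only: code append_assoc)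
  qed
qed simp

definition lit_code :: "bool \<Rightarrow> lit \<Rightarrow> item list \<Rightarrow> code" where
  "lit_code s p \<Omega> = (case filter (supports (\<not> s) p) \<Omega> of [] \<Rightarrow> [] | y # _ \<Rightarrow>
     alpha_code (\<not> s) (disj y) (lits y) p @ weakc \<Omega> [y, lit_item s p] @ [(Unary, lit_item s p # \<Omega>)])"

lemma run_lit_code:
  assumes "\<exists>y\<in>set \<Omega>. supports (\<not> s) p y"
  shows "run (lit_code s p \<Omega>) st (sq (lit_item s p # \<Omega>) # st)"
proof -
  obtain y ys where f: "filter (supports (\<not> s) p) \<Omega> = y # ys"
    using assms by (cases "filter (supports (\<not> s) p) \<Omega>") (auto simp: filter_empty_conv)
  then have "y \<in> set (filter (supports (\<not> s) p) \<Omega>)" by simp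
  then have y: "y \<in> set \<Omega>" "supports (\<not> s) p y" by simp_all
  have "run (alpha_code (\<not> s) (disj y) (lits y) p) st (sq [y, lit_item s p] # st)"
  proof -
    have "y = (\<not> s, disj y, lits y)" using y(2) by (cases y) (auto simp: supports_def)
    then show ?thesis using run_alpha_code[of "\<not> s" "disj y" "lits y" p st] y(2)
      by (auto simp: supports_def alpha_def)
  qed
  moreover have "run (weakc \<Omega> [y, lit_item s p]) (sq [y, lit_item s p] # st)
      (sq (\<Omega> @ [y, lit_item s p]) # st)" by (rule run_weakc)
  \<comment> \<open>After the weakening \<open>y\<close> occurs twice, being a member of
    \<open>\<Omega>\<close>.\<close>
  moreover have "run [(Unary, lit_item s p # \<Omega>)] (sq (\<Omega> @ [y, lit_item s p]) # st)
      (sq (lit_item s p # \<Omega>) # st)"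
    by (rule run_contr[where x = y]) (use y in \<open>auto intro: run_Nil\<close>)
  ultimately show ?thesis by (auto simp: lit_code_def f intro!: run_append)
qed

text \<open>For nonempty \<open>ps\<close> the code of the tail has left
  \<open>(s, d, ps) # \<Omega>\<close> on the stack. The literal premise in \<open>ldt_beta\<close>
  has its literal twice, hence the weakening after \<open>lit_code\<close>.\<close>

definition beta_step :: "item list \<Rightarrow> bool \<Rightarrow> bool \<Rightarrow> lit list \<Rightarrow> code" where
  "beta_step \<Omega> s d ls = (case ls of [] \<Rightarrow> [] | p # ps \<Rightarrow>
     if ps = [] then lit_code s p \<Omega>
     else [(Unary, lit_item (\<not> s) p # (s, d, ps) # \<Omega>)] @ lit_code s p \<Omega> @
       [(Unary, lit_item s p # lit_item s p # \<Omega>), (Binary s, (s, d, ls) # \<Omega>)])"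

definition beta_code :: "item list \<Rightarrow> bool \<Rightarrow> bool \<Rightarrow> lit list \<Rightarrow> code" where
  "beta_code \<Omega> s d ls = concat (map (beta_step \<Omega> s d) (rev (tails ls)))"

lemma run_beta_code:
  assumes "s \<noteq> d \<or> tl ls = []" "ls \<noteq> []" "\<forall>p\<in>set ls. \<exists>y\<in>set \<Omega>. supports (\<not> s) p y"
  shows "run (beta_code \<Omega> s d ls) st (sq ((s, d, ls) # \<Omega>) # st)"
  using assms
proof (induction ls)
  case (Cons p ps)
  have code: "beta_code \<Omega> s d (p # ps) = beta_code \<Omega> s d ps @ beta_step \<Omega> s d (p # ps)"
    by (simp add: beta_code_def)
  have lit: "run (lit_code s p \<Omega>) st (sq (lit_item s p # \<Omega>) # st)" for st
    using Cons.prems by (intro run_lit_code) simp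
  show ?case
  proof (cases "ps = []")
    case True
    \<comment> \<open>The flags may differ, but the sequents coincide because \<open>form\<close> is
      the same literal.\<close>
    moreover have "sq ((s, d, [p]) # \<Omega>) = sq (lit_item s p # \<Omega>)" by (simp add: sq_Cons)
    ultimately show ?thesis using lit[of st] by (simp add: code beta_code_def beta_step_def)
  next
    case False
    then have d: "d = (\<not> s)" using Cons.prems by auto
    have "run (beta_code \<Omega> s d ps) st (sq ((s, d, ps) # \<Omega>) # st)"
      using Cons d False by simp
    moreover have "run [(Unary, lit_item (\<not> s) p # (s, d, ps) # \<Omega>)] (sq ((s, d, ps) # \<Omega>) # st)
        (sq (lit_item (\<not> s) p # (s, d, ps) # \<Omega>) # st)"
      by (rule run_weak[where x = "lit_item (\<not> s) p"]) (auto intro: run_Nil)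
    moreover note lit[of "sq (lit_item (\<not> s) p # (s, d, ps) # \<Omega>) # st"]
    moreover have "run [(Unary, lit_item s p # lit_item s p # \<Omega>), (Binary s, (s, d, p # ps) # \<Omega>)]
        (sq (lit_item s p # \<Omega>) # sq (lit_item (\<not> s) p # (s, d, ps) # \<Omega>) # st)
        (sq ((s, d, p # ps) # \<Omega>) # st)"
      using ldt_beta[OF False, of s p \<Omega>]
      by (intro run_weak[where x = "lit_item s p"] run_Binary run_Nil) (auto simp: d)
    ultimately show ?thesis using False
      by (simp only: code beta_step_def list.case if_False) (intro run_append)
  qed
qed simp

definition closed_code :: "item list \<Rightarrow> code" where
  "closed_code \<Omega> = (case witnesses \<Omega> of [] \<Rightarrow> [] | x # _ \<Rightarrow>
     beta_code \<Omega> (side x) (disj x) (lits x) @ [(Unary, \<Omega>)])"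

text \<open>An item without literals would be a vacuous witness of closedness, although
  \<open>conv\<close> turns it into an arbitrary literal; the derivations would then be
  unsound.\<close>

definition wf_items :: "item list \<Rightarrow> bool" where
  "wf_items \<Omega> \<longleftrightarrow> (\<forall>x\<in>set \<Omega>. lits x \<noteq> [])"

lemma run_closed_code:
  assumes "closed \<Omega>" "wf_items \<Omega>"
  shows "run (closed_code \<Omega>) st (sq \<Omega> # st)"
proof -
  obtain x xs where f: "witnesses \<Omega> = x # xs"
    using assms(1) by (cases "witnesses \<Omega>") (auto simp: closed_def)
  then have "x \<in> set (witnesses \<Omega>)" by simp
  then have x: "x \<in> set \<Omega>" "beta x" "\<forall>p\<in>set (lits x). \<exists>y\<in>set \<Omega>. supports (\<not> side x) p y"
    unfolding witnesses_def by simp_all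
  have "run (beta_code \<Omega> (side x) (disj x) (lits x)) st (sq ((side x, disj x, lits x) # \<Omega>) # st)"
    using x assms(2) by (intro run_beta_code) (auto simp: beta_def wf_items_def)
  moreover have "run [(Unary, \<Omega>)] (sq ((side x, disj x, lits x) # \<Omega>) # st) (sq \<Omega> # st)"
    by (rule run_contr[where x = x]) (use x in \<open>auto intro: run_Nil\<close>)
  ultimately show ?thesis by (simp add: closed_code_def f run_append)
qed

section \<open>Replacing the premises of an inference\<close>

text \<open>From a premise \<open>E\<close> derive the conclusion \<open>\<Omega>\<close> extended by those items of \<open>E\<close> that cannot be
  cut against a sequent closed by its literals. At most the active formulas of the inference
  remain.\<close>

definition keep :: "item list \<Rightarrow> item list \<Rightarrow> item list" where
  "keep \<Omega> E = filter (\<lambda>x. \<not> closed (neg_item x # \<Omega>)) E"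

definition absorb_step :: "item list \<Rightarrow> item list \<Rightarrow> code" where
  "absorb_step B xs = (case xs of [] \<Rightarrow> [] | x # r \<Rightarrow>
     closed_code (neg_item x # r @ B) @ cutc x (r @ B))"

definition absorb :: "item list \<Rightarrow> item list \<Rightarrow> code" where
  "absorb \<Omega> E = weakc \<Omega> E @ concat (map (absorb_step (keep \<Omega> E @ \<Omega>))
     (tails (filter (\<lambda>x. closed (neg_item x # \<Omega>)) E)))"

text \<open>Which items are cut is decided against \<open>\<Omega>\<close> alone. The cuts
  themselves happen in a larger context, containing the items still to be cut and those kept, where
  the sequents stay closed by \<open>closed_mono\<close>.\<close>

lemma run_absorb:
  assumes "wf_items \<Omega>" "wf_items E"
  shows "run (absorb \<Omega> E) (sq E # st) (sq (keep \<Omega> E @ \<Omega>) # st)"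
proof -
  let ?g = "filter (\<lambda>x. closed (neg_item x # \<Omega>)) E"
  let ?B = "keep \<Omega> E @ \<Omega>"
  have "run (concat (map (absorb_step ?B) (tails g))) (sq (g @ ?B) # st) (sq ?B # st)"
    if "\<forall>x\<in>set g. closed (neg_item x # \<Omega>)" "wf_items g" for g
    using that
  proof (induction g)
    case Nil
    show ?case by (simp add: run_Nil)
  next
    case (Cons x r)
    have "run (closed_code (neg_item x # r @ ?B)) (sq (x # r @ ?B) # st)
        (sq (neg_item x # r @ ?B) # sq (x # r @ ?B) # st)"
      using Cons.prems assms
      by (intro run_closed_code) (auto simp: wf_items_def keep_def intro: closed_mono)
    moreover have "run (cutc x (r @ ?B)) (sq (neg_item x # r @ ?B) # sq (x # r @ ?B) # st)
        (sq (r @ ?B) # st)" by (rule run_cut)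
    moreover have "run (concat (map (absorb_step ?B) (tails r))) (sq (r @ ?B) # st) (sq ?B # st)"
      using Cons by (simp add: wf_items_def)
    ultimately show ?case
      by (simp only: tails.simps list.map concat.simps absorb_step_def[of _ "x # r"] list.case
          append.simps append_assoc) (intro run_append)
  qed
  then have "run (concat (map (absorb_step ?B) (tails ?g))) (sq (?g @ ?B) # st) (sq ?B # st)"
    using assms by (simp add: wf_items_def)
  moreover have "mset (\<Omega> @ E) = mset (?g @ ?B)"
    by (simp add: keep_def mset_filter)
  then have "run (weakc \<Omega> E) (sq E # st) (sq (?g @ ?B) # st)"
    using run_weakc[of \<Omega> E st] by (metis sq_cong)
  ultimately show ?thesis unfolding absorb_def by (intro run_append)
qed

text \<open>Weakening by \<open>neg_item u\<close> makes the contexts of the first cut agree, and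
  its result is the missing premise of the second. Both given sequents are consumed just once, as a
  tree-like proof requires.\<close>

definition combine :: "item list \<Rightarrow> item \<Rightarrow> item \<Rightarrow> code" where
  "combine \<Omega> u v = [(Unary, v # neg_item u # \<Omega>)] @ closed_code (neg_item v # neg_item u # \<Omega>)
     @ cutc v (neg_item u # \<Omega>) @ cutc u \<Omega>"

lemma run_combine:
  assumes "closed (neg_item v # neg_item u # \<Omega>)" "wf_items (u # v # \<Omega>)"
  shows "run (combine \<Omega> u v) (sq (v # \<Omega>) # sq (u # \<Omega>) # st) (sq \<Omega> # st)"
proof -
  have "run [(Unary, v # neg_item u # \<Omega>)] (sq (v # \<Omega>) # sq (u # \<Omega>) # st)
      (sq (v # neg_item u # \<Omega>) # sq (u # \<Omega>) # st)"
    by (rule run_weak[where x = "neg_item u"]) (auto intro: run_Nil)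
  moreover have "run (closed_code (neg_item v # neg_item u # \<Omega>)) st' (sq (neg_item v # neg_item u # \<Omega>) # st')"
    for st' using assms by (intro run_closed_code) (auto simp: wf_items_def)
  moreover note run_cut[of v "neg_item u # \<Omega>" "sq (u # \<Omega>) # st"] run_cut[of u \<Omega> st]
  ultimately show ?thesis unfolding combine_def by (meson run_append)
qed

section \<open>Translating an inference\<close>

text \<open>Recursion on formulas is confined to this preorder listing, which a worklist computes;
  collecting the literals is then a map.\<close>

primrec subforms :: "bf \<Rightarrow> bf list" where
  "subforms (BLit p) = [BLit p]"
| "subforms (And A B) = And A B # subforms A @ subforms B"
| "subforms (Or A B) = Or A B # subforms A @ subforms B"

definition bf_lits :: "bf \<Rightarrow> lit list" where
  "bf_lits A = concat (map (\<lambda>B. case B of BLit p \<Rightarrow> [p] | _ \<Rightarrow> []) (subforms A))"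

definition is_disj :: "bf \<Rightarrow> bool" where
  "is_disj A = (case A of Or _ _ \<Rightarrow> True | _ \<Rightarrow> False)"

definition item_of :: "bool \<Rightarrow> bf \<Rightarrow> item" where
  "item_of s A = (s, is_disj A, bf_lits A)"

definition items_of :: "bf lsequent \<Rightarrow> item list" where
  "items_of S = map (item_of False) (fst S) @ map (item_of True) (snd S)"

lemma bf_lits_simps [simp]: "bf_lits (BLit p) = [p]" "bf_lits (And A B) = bf_lits A @ bf_lits B"
  "bf_lits (Or A B) = bf_lits A @ bf_lits B"
  by (simp_all add: bf_lits_def)

lemma bf_lits_nonempty: "bf_lits A \<noteq> []"
  by (induction A) auto

lemma wf_items_of: "wf_items (items_of S)"
  by (auto simp: wf_items_def items_of_def item_of_def bf_lits_nonempty)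

lemma is_Or_item: "is_Or ps A \<Longrightarrow> bf_lits A = ps \<and> (is_disj A \<or> tl ps = [])"
  by (induction rule: is_Or.induct) (auto simp: is_disj_def)

lemma is_And_item: "is_And ps A \<Longrightarrow> bf_lits A = ps \<and> \<not> is_disj A"
  by (induction rule: is_And.induct) (auto simp: is_disj_def)

lemma depth_one_And: "depth_one (And A B) \<Longrightarrow> \<not> is_disj A \<and> \<not> is_disj B"
  unfolding depth_one_def by (auto elim: is_Or.cases is_And.cases dest: is_And_item)

text \<open>The asymmetry with conjunctions stems from literals, which \<open>is_disj\<close>
  classes as conjunctions.\<close>

lemma depth_one_Or:
  "depth_one (Or A B) \<Longrightarrow> (is_disj A \<or> tl (bf_lits A) = []) \<and> (is_disj B \<or> tl (bf_lits B) = [])"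
  unfolding depth_one_def by (auto elim: is_Or.cases is_And.cases dest: is_Or_item)

lemma form_Disj:
  assumes "is_Or ps A"
  shows "form (item_of s A) = Disj ps"
proof (cases "is_disj A")
  case True
  then show ?thesis using is_Or_item[OF assms] conv_Disj[OF bf_lits_nonempty[of A]]
    by (simp add: form_def item_of_def)
next
  case False
  then obtain p where "ps = [p]"
    using is_Or_item[OF assms] bf_lits_nonempty[of A] by (cases ps) auto
  then show ?thesis using is_Or_item[OF assms] by (simp add: form_def item_of_def)
qed

lemma form_Conj: "is_And ps A \<Longrightarrow> form (item_of s A) = Conj ps"
  using is_And_item[of ps A] conv_Conj[OF bf_lits_nonempty[of A]]
  by (simp add: form_def item_of_def)

lemma sq_items_of: "sq (items_of S) = (image_mset (\<lambda>A. form (item_of False A)) (mset (fst S)),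
    image_mset (\<lambda>A. form (item_of True A)) (mset (snd S)))"
proof -
  have "filter_mset side (image_mset (item_of s) M) = (if s then image_mset (item_of s) M else {#})"
    "filter_mset (\<lambda>x. \<not> side x) (image_mset (item_of s) M) = (if s then {#} else image_mset (item_of s) M)"
    for s M by (induction M) (auto simp: item_of_def)
  then show ?thesis by (simp add: sq_eq items_of_def multiset.map_comp comp_def)
qed

definition items_mset :: "bf sequent \<Rightarrow> item multiset" where
  "items_mset S = image_mset (item_of False) (fst S) + image_mset (item_of True) (snd S)"

lemma mset_items_of: "mset (items_of S) = items_mset (seq_of S)"
  by (simp add: items_of_def items_mset_def seq_of_def)

text \<open>Closedness never compares a literal with its complement, so the two axioms with
  complementary literals have to be recognized separately; \<open>neg\<close> enters only
  here.\<close>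

definition initial :: "item list \<Rightarrow> bool" where
  "initial \<Omega> = (case \<Omega> of [] \<Rightarrow> False | x # \<Omega>' \<Rightarrow> (case \<Omega>' of [] \<Rightarrow> False | y # \<Omega>'' \<Rightarrow>
     \<Omega>'' = [] \<and> tl (lits x) = [] \<and> tl (lits y) = [] \<and>
     (if side x = side y then map neg (lits x) = lits y else lits x = lits y)))"

lemma neg_neg [simp]: "neg (neg p) = p"
  by (cases p) auto

lemma ldt_initial:
  assumes "initial \<Omega>" "wf_items \<Omega>"
  shows "ldt_inf [] (sq \<Omega>)"
proof -
  obtain s d ps t e qs where \<Omega>: "\<Omega> = [(s, d, ps), (t, e, qs)]"
    using assms(1) by (auto simp: initial_def split: list.splits)
  with assms obtain p q where pq: "ps = [p]" "qs = [q]"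
    by (cases ps; cases qs) (auto simp: initial_def wf_items_def)
  show ?thesis
  proof (cases "s = t")
    case True
    then have "q = neg p" using assms(1) by (simp add: \<Omega> pq initial_def)
    then show ?thesis using common_inf.init_l[of DLit p] common_inf.init_r[of DLit p] True
      by (cases t) (auto simp: \<Omega> pq sq_Cons sq_Nil intro: ldt_inf.common)
  next
    case False
    then have "q = p" "t = (\<not> s)" using assms(1) by (auto simp: \<Omega> pq initial_def)
    then show ?thesis using ldt_init[of s d p e] by (simp add: \<Omega> pq)
  qed
qed

text \<open>With one premise, nothing but the conclusion remains of it. With two premises, one active item
  of each may remain; the conclusion is closed once both are negated, so two cuts suffice.\<close>

definition translatable :: "item list \<Rightarrow> item list list \<Rightarrow> bool" where
  "translatable \<Omega> Es \<longleftrightarrow> (Es = [] \<and> initial \<Omega>) \<or> (\<exists>E. Es = [E] \<and> keep \<Omega> E = []) \<or>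
     (\<exists>E E'. Es = [E, E'] \<and> (keep \<Omega> E = [] \<or> keep \<Omega> E' = [] \<or>
        (\<exists>u v. keep \<Omega> E = [u] \<and> keep \<Omega> E' = [v] \<and> closed (neg_item v # neg_item u # \<Omega>))))"

lemma closed_mem: "x \<in> set \<Omega> \<Longrightarrow> closed (neg_item x # \<Omega>)"
  by (rule closed_neg[of x]) auto

lemma keep_Nil:
  "\<forall>x\<in>set_mset (mset E). x \<in> set \<Omega> \<or> closed (neg_item x # \<Omega>) \<Longrightarrow> keep \<Omega> E = []"
  unfolding keep_def filter_empty_conv set_mset_mset using closed_mem by blast

text \<open>All items but the active one belong to the context, hence to \<open>\<Omega>\<close>,
  and are cut away.\<close>

lemma keep_single:
  assumes "mset E = add_mset u M" "set_mset M \<subseteq> set \<Omega>"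
  shows "keep \<Omega> E = [] \<or> keep \<Omega> E = [u]"
proof -
  have "\<forall>x\<in>#M. closed (neg_item x # \<Omega>)" using assms(2) closed_mem by blast
  then have "filter_mset (\<lambda>x. \<not> closed (neg_item x # \<Omega>)) M = {#}"
    by simp
  moreover have "mset (keep \<Omega> E) = filter_mset (\<lambda>x. \<not> closed (neg_item x # \<Omega>)) (add_mset u M)"
    by (simp add: keep_def mset_filter flip: assms(1))
  ultimately have "mset (keep \<Omega> E) \<in> {{#}, {#u#}}"
    by (simp del: filter_mset_eq_mempty_iff)
  then show ?thesis by auto
qed

lemma translatable_two:
  assumes "mset E = add_mset u M" "set_mset M \<subseteq> set \<Omega>"
    and "mset E' = add_mset v M'" "set_mset M' \<subseteq> set \<Omega>"
    and "closed (neg_item v # neg_item u # \<Omega>)"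
  shows "translatable \<Omega> [E, E']"
  using keep_single[OF assms(1,2)] keep_single[OF assms(3,4)] assms(5)
  unfolding translatable_def by blast

text \<open>In the one-premise logical rules each negated active formula is a witness, supported by
  the principal formula. In the two-premise ones the principal formula is the witness, supported by
  the two negated active formulas. For a cut these two form a complementary pair. Depth one ensures
  that the active formulas have the type of the principal one.\<close>

lemma lk1_translatable:
  assumes "lk1_inf Ps S" "mset \<Omega> = items_mset S" "list_all2 (\<lambda>E P. mset E = items_mset P) Es Ps"
  shows "translatable \<Omega> Es"
proof -
  have lk: "lk_inf Ps S" and d1: "\<forall>A \<in># fst S + snd S. depth_one A"
    using assms(1) by (auto simp: lk1_inf_def)
  have in\<Omega>: "set_mset (items_mset S) \<subseteq> set \<Omega>" using assms(2) by (metis set_mset_mset order_refl)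
  have supp: "closed \<Omega>'" if "x \<in> set \<Omega>'" "beta x" "\<forall>p\<in>set (lits x). \<exists>y\<in>set \<Omega>'. supports (\<not> side x) p y"
    for x \<Omega>' using that by (auto simp: closed_iff)
  from lk show ?thesis
  proof (cases rule: lk_inf.cases)
    case common
    then show ?thesis
    proof (cases rule: common_inf.cases)
      case (init p)
      then have "mset \<Omega> = {#(False, False, [p]), (True, False, [p])#}"
        using assms(2) by (simp add: items_mset_def item_of_def is_disj_def)
      then have "\<Omega> = [(False, False, [p]), (True, False, [p])] \<or> \<Omega> = [(True, False, [p]), (False, False, [p])]"
        by (cases \<Omega>; cases "tl \<Omega>") (auto simp: add_eq_conv_ex)
      then show ?thesis using init assms(3) by (auto simp: translatable_def initial_def)
    next
      case (init_l p)
      then have "mset \<Omega> = {#(False, False, [p]), (False, False, [neg p])#}"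
        using assms(2) by (simp add: items_mset_def item_of_def is_disj_def)
      then have "\<Omega> = [(False, False, [p]), (False, False, [neg p])] \<or> \<Omega> = [(False, False, [neg p]), (False, False, [p])]"
        by (cases \<Omega>; cases "tl \<Omega>") (auto simp: add_eq_conv_ex)
      then show ?thesis using init_l assms(3) by (auto simp: translatable_def initial_def)
    next
      case (init_r p)
      then have "mset \<Omega> = {#(True, False, [p]), (True, False, [neg p])#}"
        using assms(2) by (simp add: items_mset_def item_of_def is_disj_def)
      then have "\<Omega> = [(True, False, [p]), (True, False, [neg p])] \<or> \<Omega> = [(True, False, [neg p]), (True, False, [p])]"
        by (cases \<Omega>; cases "tl \<Omega>") (auto simp: add_eq_conv_ex)
      then show ?thesis using init_r assms(3) by (auto simp: translatable_def initial_def)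
    next
      case (cut \<Gamma> A \<Delta>)
      obtain E E' where E: "Es = [E, E']" "mset E = items_mset (\<Gamma>, add_mset A \<Delta>)"
          "mset E' = items_mset (add_mset A \<Gamma>, \<Delta>)"
        using assms(3) by (auto simp: cut list_all2_Cons2)
      have "translatable \<Omega> [E, E']"
      proof (rule translatable_two)
        show "mset E = add_mset (item_of True A) (items_mset (\<Gamma>, \<Delta>))"
          "mset E' = add_mset (item_of False A) (items_mset (\<Gamma>, \<Delta>))"
          by (simp_all add: E items_mset_def)
        show "closed (neg_item (item_of False A) # neg_item (item_of True A) # \<Omega>)"
          by (rule closed_neg[of "neg_item (item_of True A)"]) (auto simp: neg_item_def item_of_def)
      qed (use in\<Omega> cut in auto)
      then show ?thesis by (simp add: E)
    \<comment> \<open>Contractions and weakenings remain; there every formula of the premise recurs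
      in the conclusion.\<close>
    qed (use assms(3) in\<Omega> in \<open>auto simp: translatable_def list_all2_Cons2 items_mset_def image_subset_iff intro!: keep_Nil\<close>)
  next
    case (and_l A B \<Gamma> \<Delta>)
    obtain E where E: "Es = [E]" "mset E = items_mset (add_mset A (add_mset B \<Gamma>), \<Delta>)"
      using assms(3) by (auto simp: and_l list_all2_Cons2)
    let ?C = "item_of False (And A B)"
    have C: "?C \<in> set \<Omega>" and d: "\<not> is_disj A" "\<not> is_disj B"
      using in\<Omega> d1 depth_one_And by (auto simp: and_l items_mset_def)
    have "closed (neg_item (item_of False X) # \<Omega>)" if "X \<in> {A, B}" for X
      by (rule supp[of "neg_item (item_of False X)"])
        (use that C d in \<open>auto simp: beta_def supports_def alpha_def item_of_def is_disj_def intro!: bexI[of _ ?C]\<close>)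
    then have "keep \<Omega> E = []"
      by (intro keep_Nil) (use in\<Omega> in \<open>auto simp: and_l E items_mset_def image_subset_iff\<close>)
    then show ?thesis by (simp add: E translatable_def)
  next
    case (or_r \<Gamma> A B \<Delta>)
    obtain E where E: "Es = [E]" "mset E = items_mset (\<Gamma>, add_mset A (add_mset B \<Delta>))"
      using assms(3) by (auto simp: or_r list_all2_Cons2)
    let ?C = "item_of True (Or A B)"
    have C: "?C \<in> set \<Omega>" and d: "is_disj A \<or> tl (bf_lits A) = []" "is_disj B \<or> tl (bf_lits B) = []"
      using in\<Omega> d1 depth_one_Or by (auto simp: or_r items_mset_def)
    have "closed (neg_item (item_of True X) # \<Omega>)" if "X \<in> {A, B}" for X
      by (rule supp[of "neg_item (item_of True X)"])
        (use that C d in \<open>auto simp: beta_def supports_def alpha_def item_of_def is_disj_def intro!: bexI[of _ ?C]\<close>)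
    then have "keep \<Omega> E = []"
      by (intro keep_Nil) (use in\<Omega> in \<open>auto simp: or_r E items_mset_def image_subset_iff\<close>)
    then show ?thesis by (simp add: E translatable_def)
  next
    case (and_r \<Gamma> A \<Delta> B)
    obtain E E' where E: "Es = [E, E']" "mset E = items_mset (\<Gamma>, add_mset A \<Delta>)"
        "mset E' = items_mset (\<Gamma>, add_mset B \<Delta>)"
      using assms(3) by (auto simp: and_r list_all2_Cons2)
    let ?C = "item_of True (And A B)"
    have C: "?C \<in> set \<Omega>" and d: "\<not> is_disj A" "\<not> is_disj B"
      using in\<Omega> d1 depth_one_And by (auto simp: and_r items_mset_def)
    have "translatable \<Omega> [E, E']"
    proof (rule translatable_two)
      show "mset E = add_mset (item_of True A) (items_mset (\<Gamma>, \<Delta>))"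
        "mset E' = add_mset (item_of True B) (items_mset (\<Gamma>, \<Delta>))"
        by (simp_all add: E items_mset_def)
      show "closed (neg_item (item_of True B) # neg_item (item_of True A) # \<Omega>)"
        by (rule supp[of ?C])
          (use C d in \<open>auto simp: beta_def supports_def alpha_def item_of_def is_disj_def\<close>)
    qed (use in\<Omega> in \<open>auto simp: and_r items_mset_def\<close>)
    then show ?thesis by (simp add: E)
  next
    case (or_l A \<Gamma> \<Delta> B)
    obtain E E' where E: "Es = [E, E']" "mset E = items_mset (add_mset A \<Gamma>, \<Delta>)"
        "mset E' = items_mset (add_mset B \<Gamma>, \<Delta>)"
      using assms(3) by (auto simp: or_l list_all2_Cons2)
    let ?C = "item_of False (Or A B)"
    have C: "?C \<in> set \<Omega>" and d: "is_disj A \<or> tl (bf_lits A) = []" "is_disj B \<or> tl (bf_lits B) = []"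
      using in\<Omega> d1 depth_one_Or by (auto simp: or_l items_mset_def)
    have "translatable \<Omega> [E, E']"
    proof (rule translatable_two)
      show "mset E = add_mset (item_of False A) (items_mset (\<Gamma>, \<Delta>))"
        "mset E' = add_mset (item_of False B) (items_mset (\<Gamma>, \<Delta>))"
        by (simp_all add: E items_mset_def)
      show "closed (neg_item (item_of False B) # neg_item (item_of False A) # \<Omega>)"
        by (rule supp[of ?C])
          (use C d in \<open>auto simp: beta_def supports_def alpha_def item_of_def is_disj_def\<close>)
    qed (use in\<Omega> in \<open>auto simp: or_l items_mset_def\<close>)
    then show ?thesis by (simp add: E)
  qed
qed

section \<open>Dag-like proofs\<close>

definition lines :: "code \<Rightarrow> item list list" where
  "lines c = map snd (filter (\<lambda>i. fst i \<noteq> Nip \<and> fst i \<noteq> Swap) c)"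

primrec derivable :: "dt sequent set \<Rightarrow> dt sequent list \<Rightarrow> bool" where
  "derivable P [] = True"
| "derivable P (S # Ss) = ((\<exists>Ps. set Ps \<subseteq> P \<and> ldt_inf Ps S) \<and> derivable (insert S P) Ss)"

lemma derivable_append: "derivable P (Ss @ Ts) \<longleftrightarrow> derivable P Ss \<and> derivable (P \<union> set Ss) Ts"
  by (induction Ss arbitrary: P) simp_all

lemma derivable_mono: "derivable P Ss \<Longrightarrow> P \<subseteq> Q \<Longrightarrow> derivable Q Ss"
proof (induction Ss arbitrary: P Q)
  case (Cons S Ss)
  have "derivable (insert S Q) Ss"
    using Cons.prems by (intro Cons.IH[of "insert S P" "insert S Q"]) auto
  moreover obtain Ps where "set Ps \<subseteq> P" "ldt_inf Ps S" using Cons.prems(1) by auto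
  then have "\<exists>Ps. set Ps \<subseteq> Q \<and> ldt_inf Ps S" using Cons.prems(2) by (intro exI[of _ Ps]) simp
  ultimately show ?case by simp
qed simp

lemma lines_append [simp]: "lines (c @ c') = lines c @ lines c'"
  by (simp add: lines_def)

lemma lines_Nil [simp]: "lines [] = []"
  by (simp add: lines_def)

lemma derivable_concat:
  "(\<And>c. c \<in> set cs \<Longrightarrow> derivable P (map sq (lines c))) \<Longrightarrow> derivable P (map sq (lines (concat cs)))"
proof (induction cs)
  case (Cons c cs)
  then have "derivable P (map sq (lines (concat cs)))" by simp
  from derivable_mono[OF this, of "P \<union> sq ` set (lines c)"] Cons.prems show ?case
    by (simp add: derivable_append)
qed simp

lemma set_lines_concat: "set (lines (concat cs)) = (\<Union>c\<in>set cs. set (lines c))"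
  by (induction cs) auto

text \<open>Every stack entry is an initial one or a line already emitted, so the premises taken
  from the stack are available in the dag-like derivation.\<close>

lemma run_lines:
  "run c st st' \<Longrightarrow> set st \<subseteq> P \<Longrightarrow>
    derivable P (map sq (lines c)) \<and> set st' \<subseteq> P \<union> sq ` set (lines c)"
proof (induction arbitrary: P rule: run.induct)
  case (run_Push \<Omega> c st st')
  have "\<exists>Ps. set Ps \<subseteq> P \<and> ldt_inf Ps (sq \<Omega>)"
    using run_Push.hyps(1) by (intro exI[of _ "[]"]) simp
  moreover have "set (sq \<Omega> # st) \<subseteq> insert (sq \<Omega>) P" using run_Push.prems by auto
  note run_Push.IH[OF this]
  moreover have "lines ((Push, \<Omega>) # c) = \<Omega> # lines c" by (simp add: lines_def)
  ultimately show ?case by simp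
next
  case (run_Unary S \<Omega> c st st')
  have "\<exists>Ps. set Ps \<subseteq> P \<and> ldt_inf Ps (sq \<Omega>)"
    using run_Unary.hyps(1) run_Unary.prems by (intro exI[of _ "[S]"]) simp
  moreover have "set (sq \<Omega> # st) \<subseteq> insert (sq \<Omega>) P" using run_Unary.prems by auto
  note run_Unary.IH[OF this]
  moreover have "lines ((Unary, \<Omega>) # c) = \<Omega> # lines c" by (simp add: lines_def)
  ultimately show ?case by simp
next
  case (run_Binary b S S' \<Omega> c st st')
  have "\<exists>Ps. set Ps \<subseteq> P \<and> ldt_inf Ps (sq \<Omega>)"
    using run_Binary.hyps(1) run_Binary.prems
    by (intro exI[of _ "if b then [S, S'] else [S', S]"]) simp
  moreover have "set (sq \<Omega> # st) \<subseteq> insert (sq \<Omega>) P" using run_Binary.prems by auto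
  note run_Binary.IH[OF this]
  moreover have "lines ((Binary b, \<Omega>) # c) = \<Omega> # lines c" by (simp add: lines_def)
  ultimately show ?case by simp
qed (simp_all add: lines_def)

text \<open>By \<open>keep_single\<close>, a premise of a two-premise inference retains at most one
  item; lines retaining more are passed over.\<close>

definition units :: "item list \<Rightarrow> item list list \<Rightarrow> item list" where
  "units \<Omega> Es = concat (map (\<lambda>E. if tl (keep \<Omega> E) = [] then keep \<Omega> E else []) Es)"

definition dag_node :: "item list \<Rightarrow> item list list \<Rightarrow> code" where
  "dag_node \<Omega> Es = (if initial \<Omega> then [(Push, \<Omega>)] else []) @ concat (map (absorb \<Omega>) Es) @
     concat (map (\<lambda>u. concat (map (\<lambda>v.
        if closed (neg_item v # neg_item u # \<Omega>) then combine \<Omega> u v else []) (units \<Omega> Es)))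
        (units \<Omega> Es)) @
     [(Unary, lit_item False (Pos 0) # \<Omega>), (Swap, []), (Unary, lit_item True (Pos 0) # \<Omega>)] @
     cutc (lit_item False (Pos 0)) \<Omega>"

text \<open>The last three lines of \<open>dag_node\<close> derive \<open>\<Omega>\<close> again, so that it comes last.\<close>

lemma run_repeat:
  "run ([(Unary, lit_item False p # \<Omega>), (Swap, []), (Unary, lit_item True p # \<Omega>)] @
     cutc (lit_item False p) \<Omega>) [sq \<Omega>, sq \<Omega>] [sq \<Omega>]"
proof (rule run_append)
  show "run [(Unary, lit_item False p # \<Omega>), (Swap, []), (Unary, lit_item True p # \<Omega>)] [sq \<Omega>, sq \<Omega>]
      [sq (lit_item True p # \<Omega>), sq (lit_item False p # \<Omega>)]"
    by (intro run_weak[where x = "lit_item False p"] run_Swap run_weak[where x = "lit_item True p"]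
        run_Nil) auto
  show "run (cutc (lit_item False p) \<Omega>) [sq (lit_item True p # \<Omega>), sq (lit_item False p # \<Omega>)] [sq \<Omega>]"
    using run_cut[of "lit_item False p" \<Omega> "[]"] by (simp add: neg_item_def lit_item_def)
qed

text \<open>The true premises \<open>Es'\<close> serve only to show that \<open>\<Omega>\<close> is
  among the lines; each block of code is correct for arbitrary earlier lines
  \<open>Es\<close>.\<close>

lemma dag_node_derivable:
  assumes "translatable \<Omega> Es'" "set Es' \<subseteq> set Es" "sq ` set Es \<subseteq> P"
    and "wf_items \<Omega>" "\<And>E. E \<in> set Es \<Longrightarrow> wf_items E"
  shows "derivable P (map sq (lines (dag_node \<Omega> Es)))"
proof -
  define us where "us = units \<Omega> Es"
  define A where "A = (if initial \<Omega> then [(Push, \<Omega>)] else [])"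
  define B where "B = concat (map (absorb \<Omega>) Es)"
  define C where "C = concat (map (\<lambda>u. concat (map (\<lambda>v.
        if closed (neg_item v # neg_item u # \<Omega>) then combine \<Omega> u v else []) us)) us)"
  \<comment> \<open>\<open>P1\<close>, \<open>P2\<close>, \<open>P3\<close> are the sequents
    available after the blocks \<open>A\<close>, \<open>B\<close>, \<open>C\<close>.\<close>
  define P1 where "P1 = P \<union> sq ` set (lines A)"
  define P2 where "P2 = P1 \<union> sq ` set (lines B)"
  define P3 where "P3 = P2 \<union> sq ` set (lines C)"
  have A: "derivable P (map sq (lines A))"
    using ldt_initial[OF _ assms(4)] by (auto simp: A_def lines_def intro: exI[of _ "[]"])
  have B0: "derivable P1 (map sq (lines (absorb \<Omega> E)))"
    "sq (keep \<Omega> E @ \<Omega>) \<in> P1 \<union> sq ` set (lines (absorb \<Omega> E))" if "E \<in> set Es" for E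
    using run_lines[OF run_absorb[OF assms(4,5), of E "[]"], of P1] that assms(3)
    by (auto simp: P1_def)
  have B: "derivable P1 (map sq (lines B))"
    unfolding B_def by (rule derivable_concat) (use B0 in auto)
  have keep: "sq (keep \<Omega> E @ \<Omega>) \<in> P2" if "E \<in> set Es" for E
    using B0(2)[OF that] that by (auto simp: P2_def B_def set_lines_concat)
  have us: "sq (u # \<Omega>) \<in> P2 \<and> lits u \<noteq> []" if u: "u \<in> set us" for u
  proof -
    obtain E where E: "E \<in> set Es" "tl (keep \<Omega> E) = []" "u \<in> set (keep \<Omega> E)"
      using u by (auto simp: us_def units_def split: if_splits)
    then have "keep \<Omega> E = [u]" by (cases "keep \<Omega> E") auto
    with keep[OF E(1)] E assms(5)[OF E(1)] show ?thesis
      by (auto simp: wf_items_def keep_def)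
  qed
  have C0: "derivable P2 (map sq (lines (combine \<Omega> u v)))"
    "sq \<Omega> \<in> P2 \<union> sq ` set (lines (combine \<Omega> u v))"
    if "u \<in> set us" "v \<in> set us" "closed (neg_item v # neg_item u # \<Omega>)" for u v
  proof -
    have "wf_items (u # v # \<Omega>)" using us that assms(4) by (auto simp: wf_items_def)
    from run_lines[OF run_combine[OF that(3) this, of "[]"], of P2] us that
    show "derivable P2 (map sq (lines (combine \<Omega> u v)))"
      "sq \<Omega> \<in> P2 \<union> sq ` set (lines (combine \<Omega> u v))" by auto
  qed
  have C: "derivable P2 (map sq (lines C))"
    unfolding C_def by (intro derivable_concat) (auto intro!: derivable_concat C0 split: if_splits)
  have "sq \<Omega> \<in> P3"
  proof -
    from assms(1) consider "initial \<Omega>" | E where "E \<in> set Es" "keep \<Omega> E = []"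
      | E E' u v where "E \<in> set Es" "E' \<in> set Es" "keep \<Omega> E = [u]" "keep \<Omega> E' = [v]"
          "closed (neg_item v # neg_item u # \<Omega>)"
      using assms(2) unfolding translatable_def by fastforce
    then show ?thesis
    proof cases
      case 1
      then show ?thesis by (simp add: P3_def P2_def P1_def A_def lines_def)
    next
      case 2
      then show ?thesis using keep[of E] by (simp add: P3_def)
    next
      case 3
      then have uv: "u \<in> set us" "v \<in> set us" by (auto simp: us_def units_def intro: bexI[of _ E] bexI[of _ E'])
      then have "set (lines (combine \<Omega> u v)) \<subseteq> set (lines C)"
        using 3(5) by (fastforce simp: C_def set_lines_concat)
      then show ?thesis using C0(2)[OF uv 3(5)] by (auto simp: P3_def)
    qed
  qed
  then have "derivable P3 (map sq (lines ([(Unary, lit_item False (Pos 0) # \<Omega>), (Swap, []),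
      (Unary, lit_item True (Pos 0) # \<Omega>)] @ cutc (lit_item False (Pos 0)) \<Omega>)))"
    using run_lines[OF run_repeat[of "Pos 0" \<Omega>], of P3] by simp
  with A B C show ?thesis
    unfolding dag_node_def us_def[symmetric] A_def[symmetric] B_def[symmetric] C_def[symmetric]
    by (simp only: lines_append map_append derivable_append P1_def P2_def P3_def set_map image_Un Un_assoc)
qed

lemma lines_dag_node: "\<exists>L. lines (dag_node \<Omega> Es) = L @ [\<Omega>]"
  by (simp add: dag_node_def lines_def cutc_def)

text \<open>A suffix of the reversed proof is a line followed by all lines before it.\<close>

definition dag_code :: "item list list \<Rightarrow> code" where
  "dag_code \<Omega>s = concat (map (\<lambda>t. case t of [] \<Rightarrow> [] | \<Omega> # Es \<Rightarrow> dag_node \<Omega> Es) (rev (tails (rev \<Omega>s))))"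

lemma dag_code_snoc: "dag_code (\<Omega>s @ [\<Omega>]) = dag_code \<Omega>s @ dag_node \<Omega> (rev \<Omega>s)"
  by (simp add: dag_code_def)

lemma dag_code_derivable:
  assumes "\<forall>i<length \<Omega>s. \<exists>Es. set Es \<subseteq> set (take i \<Omega>s) \<and> translatable (\<Omega>s ! i) Es"
    and "\<And>\<Omega>. \<Omega> \<in> set \<Omega>s \<Longrightarrow> wf_items \<Omega>"
  shows "derivable {} (map sq (lines (dag_code \<Omega>s))) \<and> sq ` set \<Omega>s \<subseteq> sq ` set (lines (dag_code \<Omega>s))"
  using assms
proof (induction \<Omega>s rule: rev_induct)
  case (snoc \<Omega> \<Omega>s)
  have prem: "\<exists>Es. set Es \<subseteq> set (take i \<Omega>s) \<and> translatable (\<Omega>s ! i) Es" if "i < length \<Omega>s" for i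
    using snoc.prems(1)[rule_format, of i] that by (simp add: nth_append)
  have IH: "derivable {} (map sq (lines (dag_code \<Omega>s)))" "sq ` set \<Omega>s \<subseteq> sq ` set (lines (dag_code \<Omega>s))"
    using snoc.IH prem snoc.prems(2) by auto
  obtain Es where "set Es \<subseteq> set \<Omega>s" "translatable \<Omega> Es"
    using snoc.prems(1)[rule_format, of "length \<Omega>s"] by auto
  then have "derivable (sq ` set (lines (dag_code \<Omega>s))) (map sq (lines (dag_node \<Omega> (rev \<Omega>s))))"
    using IH(2) snoc.prems(2) by (intro dag_node_derivable) auto
  with IH lines_dag_node[of \<Omega> "rev \<Omega>s"] show ?case
    by (auto simp: dag_code_snoc derivable_append)
qed (simp add: dag_code_def)

lemma derivable_nth:
  "derivable P Ss \<Longrightarrow> i < length Ss \<Longrightarrow> \<exists>Ps. set Ps \<subseteq> P \<union> set (take i Ss) \<and> ldt_inf Ps (Ss ! i)"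
proof (induction Ss arbitrary: P i)
  case (Cons S Ss)
  show ?case
  proof (cases i)
    case (Suc j)
    then obtain Ps where "set Ps \<subseteq> insert S P \<union> set (take j Ss)" "ldt_inf Ps (Ss ! j)"
      using Cons.IH[of "insert S P" j] Cons.prems by auto
    then show ?thesis using Suc by auto
  qed (use Cons.prems in auto)
qed simp

lemma dag_code_proof:
  assumes "dag_proof lk1_inf (map seq_of \<pi>) S"
  shows "dag_proof ldt_inf (map sq (lines (dag_code (map items_of \<pi>)))) (sq (items_of (last \<pi>)))"
proof -
  let ?\<Omega>s = "map items_of \<pi>"
  have ne: "\<pi> \<noteq> []" and
    inf: "\<And>i. i < length \<pi> \<Longrightarrow> \<exists>Ps. set Ps \<subseteq> set (take i (map seq_of \<pi>)) \<and> lk1_inf Ps (map seq_of \<pi> ! i)"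
    using assms by (auto simp: dag_proof_def)
  have "\<exists>Es. set Es \<subseteq> set (take i ?\<Omega>s) \<and> translatable (?\<Omega>s ! i) Es" if i: "i < length \<pi>" for i
  proof -
    obtain Ps where Ps: "set Ps \<subseteq> set (take i (map seq_of \<pi>))" "lk1_inf Ps (map seq_of \<pi> ! i)"
      using inf[OF i] by blast
    have "\<exists>E. E \<in> set (take i ?\<Omega>s) \<and> mset E = items_mset P" if P: "P \<in> set Ps" for P
    proof -
      obtain T where "T \<in> set (take i \<pi>)" "P = seq_of T" using Ps(1) P by (auto simp: take_map)
      then show ?thesis by (intro exI[of _ "items_of T"]) (auto simp: take_map mset_items_of)
    qed
    then obtain e where e: "\<And>P. P \<in> set Ps \<Longrightarrow> e P \<in> set (take i ?\<Omega>s) \<and> mset (e P) = items_mset P"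
      by metis
    have "translatable (?\<Omega>s ! i) (map e Ps)"
      using i e by (intro lk1_translatable[OF Ps(2)])
        (auto simp: mset_items_of list_all2_map1 list_all2_same)
    then show ?thesis using e by (intro exI[of _ "map e Ps"]) auto
  qed
  then have der: "derivable {} (map sq (lines (dag_code ?\<Omega>s)))"
    by (intro dag_code_derivable[THEN conjunct1]) (auto simp: wf_items_of)
  obtain \<pi>' T where \<pi>: "\<pi> = \<pi>' @ [T]" using ne by (metis rev_exhaust)
  obtain L where "lines (dag_code ?\<Omega>s) = L @ [items_of T]"
    using lines_dag_node[of "items_of T" "rev (map items_of \<pi>')"] by (auto simp: \<pi> dag_code_snoc)
  then show ?thesis using derivable_nth[OF der] by (simp add: dag_proof_def \<pi>)
qed

section \<open>Tree-like proofs\<close>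

text \<open>If the first premise alone yields \<open>\<Omega>\<close>, \<open>Nip\<close> discards
  the second subtree. Otherwise \<open>u # \<Omega>\<close> waits below while the second premise is
  treated, and is itself discarded if that one suffices.\<close>

definition tree_node :: "item list \<Rightarrow> item list list \<Rightarrow> code" where
  "tree_node \<Omega> Es = (case Es of [] \<Rightarrow> [(Push, \<Omega>)] | E # Es' \<Rightarrow> absorb \<Omega> E @
     (case Es' of [] \<Rightarrow> [] | E' # _ \<Rightarrow>
       (case keep \<Omega> E of [] \<Rightarrow> [(Nip, [])] | u # _ \<Rightarrow> [(Swap, [])] @ absorb \<Omega> E' @
         (case keep \<Omega> E' of [] \<Rightarrow> [(Nip, [])] | v # _ \<Rightarrow> combine \<Omega> u v))))"

lemma run_tree_node:
  assumes "translatable \<Omega> Es" "wf_items \<Omega>" "\<And>E. E \<in> set Es \<Longrightarrow> wf_items E"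
  shows "run (tree_node \<Omega> Es) (map sq Es @ st) (sq \<Omega> # st)"
proof -
  from assms(1) consider "Es = []" "initial \<Omega>" | E where "Es = [E]" "keep \<Omega> E = []"
    | E E' where "Es = [E, E']" "keep \<Omega> E = []"
    | E E' u us where "Es = [E, E']" "keep \<Omega> E = u # us" "keep \<Omega> E' = []"
    | E E' u v where "Es = [E, E']" "keep \<Omega> E = [u]" "keep \<Omega> E' = [v]"
        "closed (neg_item v # neg_item u # \<Omega>)"
    unfolding translatable_def by (metis neq_Nil_conv)
  then show ?thesis
  proof cases
    case 1
    then show ?thesis using ldt_initial[OF _ assms(2)]
      by (auto simp: tree_node_def intro: run_Push run_Nil)
  next
    case 2
    then show ?thesis using run_absorb[of \<Omega> E st] assms by (simp add: tree_node_def)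
  next
    case 3
    have "run (absorb \<Omega> E @ [(Nip, [])]) (sq E # sq E' # st) (sq \<Omega> # st)"
      using run_absorb[of \<Omega> E "sq E' # st"] assms 3
      by (intro run_append[of "absorb \<Omega> E"]) (auto intro!: run.intros)
    then show ?thesis using 3 by (simp add: tree_node_def)
  next
    case 4
    have "run (absorb \<Omega> E) (sq E # sq E' # st) (sq (keep \<Omega> E @ \<Omega>) # sq E' # st)"
      using run_absorb[of \<Omega> E "sq E' # st"] assms 4 by simp
    moreover have "run [(Swap, [])] (sq (keep \<Omega> E @ \<Omega>) # sq E' # st) (sq E' # sq (keep \<Omega> E @ \<Omega>) # st)"
      by (intro run.intros)
    moreover have "run (absorb \<Omega> E') (sq E' # sq (keep \<Omega> E @ \<Omega>) # st) (sq \<Omega> # sq (keep \<Omega> E @ \<Omega>) # st)"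
      using run_absorb[of \<Omega> E' "sq (keep \<Omega> E @ \<Omega>) # st"] assms 4 by simp
    moreover have "run [(Nip, [])] (sq \<Omega> # sq (keep \<Omega> E @ \<Omega>) # st) (sq \<Omega> # st)"
      by (intro run.intros)
    ultimately have "run (absorb \<Omega> E @ [(Swap, [])] @ absorb \<Omega> E' @ [(Nip, [])])
        (sq E # sq E' # st) (sq \<Omega> # st)" by (meson run_append)
    then show ?thesis using 4 by (simp add: tree_node_def)
  next
    case 5
    have "run (absorb \<Omega> E) (sq E # sq E' # st) (sq (u # \<Omega>) # sq E' # st)"
      using run_absorb[of \<Omega> E "sq E' # st"] assms 5 by simp
    moreover have "run [(Swap, [])] (sq (u # \<Omega>) # sq E' # st) (sq E' # sq (u # \<Omega>) # st)"
      by (intro run.intros)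
    moreover have "run (absorb \<Omega> E') (sq E' # sq (u # \<Omega>) # st) (sq (v # \<Omega>) # sq (u # \<Omega>) # st)"
      using run_absorb[of \<Omega> E' "sq (u # \<Omega>) # st"] assms 5 by simp
    moreover have "u \<in> set E" "v \<in> set E'"
      using 5 by (metis filter_is_subset keep_def list.set_intros(1) subsetD)+
    then have "run (combine \<Omega> u v) (sq (v # \<Omega>) # sq (u # \<Omega>) # st) (sq \<Omega> # st)"
      using 5 assms(2) assms(3)[of E] assms(3)[of E']
      by (intro run_combine) (auto simp: wf_items_def)
    ultimately have "run (absorb \<Omega> E @ [(Swap, [])] @ absorb \<Omega> E' @ combine \<Omega> u v)
        (sq E # sq E' # st) (sq \<Omega> # st)" by (meson run_append)
    then show ?thesis using 5 by (simp add: tree_node_def)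
  qed
qed

primrec preorder :: "'s ptree \<Rightarrow> 's ptree list" where
  "preorder (Infer S ts) = Infer S ts # concat (map preorder ts)"

text \<open>Reversed preorder visits the children from right to left and before their parent, which
  leaves the first premise on top of the stack.\<close>

definition tree_code :: "bf lsequent ptree \<Rightarrow> code" where
  "tree_code \<tau> = concat (map (\<lambda>t. case t of Infer S ts \<Rightarrow>
     tree_node (items_of S) (map (\<lambda>t'. items_of (root t')) ts)) (rev (preorder \<tau>)))"

lemma tree_code_Infer: "tree_code (Infer S ts) = concat (map tree_code (rev ts)) @
    tree_node (items_of S) (map (\<lambda>t. items_of (root t)) ts)"
proof -
  have "concat (map f (rev (concat (map preorder us)))) =
      concat (map (\<lambda>t. concat (map f (rev (preorder t)))) (rev us))"
    for f :: "bf lsequent ptree \<Rightarrow> code" and us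
    by (induction us) auto
  then show ?thesis by (simp add: tree_code_def[abs_def])
qed

lemma run_tree_code:
  "valid_tree lk1_inf (map_ptree seq_of \<tau>) \<Longrightarrow> run (tree_code \<tau>) st (sq (items_of (root \<tau>)) # st)"
proof (induction \<tau> arbitrary: st)
  case (Infer S ts)
  have inf: "lk1_inf (map root (map (map_ptree seq_of) ts)) (seq_of S)"
    and valid: "\<forall>t\<in>set ts. valid_tree lk1_inf (map_ptree seq_of t)"
    using Infer.prems by (auto elim: valid_tree.cases)
  have "run (concat (map tree_code (rev us))) st (map (\<lambda>t. sq (items_of (root t))) us @ st)"
    if "set us \<subseteq> set ts" for us using that
  proof (induction us)
    case (Cons t us)
    then have "run (concat (map tree_code (rev us))) st (map (\<lambda>t. sq (items_of (root t))) us @ st)"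
      "run (tree_code t) st' (sq (items_of (root t)) # st')" for st'
      using Infer.IH valid by auto
    from run_append[OF this] show ?case by simp
  qed (simp add: run_Nil)
  moreover have "translatable (items_of S) (map (\<lambda>t. items_of (root t)) ts)"
    by (rule lk1_translatable[OF inf])
      (auto simp: mset_items_of list_all2_map1 list_all2_map2 list_all2_same ptree.map_sel)
  from run_tree_node[OF this, of st] have "run (tree_node (items_of S) (map (\<lambda>t. items_of (root t)) ts))
      (map (\<lambda>t. sq (items_of (root t))) ts @ st) (sq (items_of S) # st)"
    by (force simp: wf_items_of comp_def)
  ultimately show ?case using run_append by (fastforce simp: tree_code_Infer)
qed

text \<open>An instruction that lacks arguments is skipped.\<close>

definition exec_step :: "instr \<times> dt lsequent \<Rightarrow> dt lsequent ptree list \<Rightarrow> dt lsequent ptree list" where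
  "exec_step i ts = (if fst i = Push then Infer (snd i) [] # ts else case ts of [] \<Rightarrow> ts | t # ts' \<Rightarrow>
     if fst i = Unary then Infer (snd i) [t] # ts' else case ts' of [] \<Rightarrow> ts | t' # ts'' \<Rightarrow>
     if fst i = Binary True then Infer (snd i) [t, t'] # ts'' else
     if fst i = Binary False then Infer (snd i) [t', t] # ts'' else
     if fst i = Nip then t # ts'' else t' # t # ts'')"

definition exec :: "code \<Rightarrow> dt lsequent ptree list" where
  "exec c = fold exec_step (map (\<lambda>i. (fst i, toseq (snd i))) c) []"

lemma exec_step_simps [simp]:
  "exec_step (Push, S) ts = Infer S [] # ts"
  "exec_step (Unary, S) (t # ts) = Infer S [t] # ts"
  "exec_step (Binary b, S) (t # t' # ts) = Infer S (if b then [t, t'] else [t', t]) # ts"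
  "exec_step (Nip, S) (t # t' # ts) = t # ts"
  "exec_step (Swap, S) (t # t' # ts) = t' # t # ts"
  by (simp_all add: exec_step_def)

definition proves :: "dt lsequent ptree \<Rightarrow> dt sequent \<Rightarrow> bool" where
  "proves t S \<longleftrightarrow> tree_proof ldt_inf (map_ptree seq_of t) S"

lemma proves_Infer:
  assumes "list_all2 proves ts Ps" "ldt_inf Ps (sq \<Omega>)"
  shows "proves (Infer (toseq \<Omega>) ts) (sq \<Omega>)"
proof -
  have "map root (map (map_ptree seq_of) ts) = Ps"
    "\<forall>t\<in>set ts. valid_tree ldt_inf (map_ptree seq_of t)"
    using assms(1) by (induction rule: list_all2_induct) (auto simp: proves_def tree_proof_def)
  then show ?thesis using assms(2)
    by (auto simp: proves_def tree_proof_def sq_def intro!: valid_tree.intros)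
qed

text \<open>The stack of sequents in \<open>run\<close> specifies the stack of trees entry by
  entry.\<close>

lemma run_exec_step:
  "run c st st' \<Longrightarrow> list_all2 proves ts st \<Longrightarrow>
    list_all2 proves (fold exec_step (map (\<lambda>i. (fst i, toseq (snd i))) c) ts) st'"
proof (induction arbitrary: ts rule: run.induct)
  case (run_Push \<Omega> c st st')
  then show ?case using proves_Infer[of "[]" "[]" \<Omega>] by simp
next
  case (run_Unary S \<Omega> c st st')
  then obtain t us where "ts = t # us" "proves t S" "list_all2 proves us st"
    by (auto simp: list_all2_Cons2)
  then show ?case using run_Unary proves_Infer[of "[t]" "[S]" \<Omega>] by simp
next
  case (run_Binary b S S' \<Omega> c st st')
  then obtain t t' us where ts: "ts = t # t' # us" "proves t S" "proves t' S'" "list_all2 proves us st"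
    by (auto simp: list_all2_Cons2)
  have "proves (Infer (toseq \<Omega>) (if b then [t, t'] else [t', t])) (sq \<Omega>)"
    by (rule proves_Infer[OF _ run_Binary.hyps(1)]) (use ts in auto)
  with ts show ?case using run_Binary.IH by simp
qed (auto simp: list_all2_Cons2)

lemma exec_tree_code:
  assumes "tree_proof lk1_inf (map_ptree seq_of \<tau>) S"
  obtains t where "exec (tree_code \<tau>) = [t]"
    "tree_proof ldt_inf (map_ptree seq_of t) (sq (items_of (root \<tau>)))"
proof -
  have "list_all2 proves (exec (tree_code \<tau>))
      [sq (items_of (root \<tau>))]"
    unfolding exec_def
    by (rule run_exec_step[OF run_tree_code]) (use assms in \<open>auto simp: tree_proof_def\<close>)
  then show thesis using that by (auto simp: list_all2_Cons2 proves_def)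
qed

section \<open>Polynomial-time functions on encoded values\<close>

text \<open>Values are fixed on encodings only, whereas the time bound inside
  \<open>polytime\<close> covers all data.\<close>

definition pt :: "('a \<Rightarrow> data) \<Rightarrow> ('b \<Rightarrow> data) \<Rightarrow> ('a \<Rightarrow> 'b) \<Rightarrow> bool" where
  "pt a b f \<longleftrightarrow> (\<exists>F. polytime F \<and> (\<forall>x. F (a x) = b (f x)))"

definition e_bool :: "bool \<Rightarrow> data" where
  "e_bool b = (if b then Node Leaf Leaf else Leaf)"

definition e_pair :: "('a \<Rightarrow> data) \<Rightarrow> ('b \<Rightarrow> data) \<Rightarrow> 'a \<times> 'b \<Rightarrow> data" where
  "e_pair a b x = Node (a (fst x)) (b (snd x))"

definition e_list :: "('a \<Rightarrow> data) \<Rightarrow> 'a list \<Rightarrow> data" where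
  "e_list a xs = enc_list (map a xs)"

lemma e_list_simps [simp]: "e_list a [] = Leaf" "e_list a (x # xs) = Node (a x) (e_list a xs)"
  "dl (e_list a xs) = map a xs"
  by (simp_all add: e_list_def)

lemma ptI: "polytime F \<Longrightarrow> (\<And>x. F (a x) = b (f x)) \<Longrightarrow> pt a b f"
  unfolding pt_def by blast

lemma ptE: "pt a b f \<Longrightarrow> (\<And>F. polytime F \<Longrightarrow> (\<And>x. F (a x) = b (f x)) \<Longrightarrow> thesis) \<Longrightarrow> thesis"
  unfolding pt_def by blast

lemma pt_id: "pt e e (\<lambda>x. x)"
  by (rule ptI[OF polytime_id]) simp

lemma pt_const: "pt e a (\<lambda>x. c)"
  by (rule ptI[OF polytime_const[of "a c"]]) simp

lemma pt_comp:
  assumes "pt a b f" "pt e a g"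
  shows "pt e b (\<lambda>x. f (g x))"
proof -
  obtain F where F: "polytime F" "\<And>x. F (a x) = b (f x)" using assms(1) by (rule ptE) blast
  obtain G where G: "polytime G" "\<And>x. G (e x) = a (g x)" using assms(2) by (rule ptE) blast
  show ?thesis by (rule ptI[OF polytime_comp[OF F(1) G(1)]]) (simp add: F G)
qed

lemma pt_Pair:
  assumes "pt e a f" "pt e b g"
  shows "pt e (e_pair a b) (\<lambda>x. (f x, g x))"
proof -
  obtain F where F: "polytime F" "\<And>x. F (e x) = a (f x)" using assms(1) by (rule ptE) blast
  obtain G where G: "polytime G" "\<And>x. G (e x) = b (g x)" using assms(2) by (rule ptE) blast
  show ?thesis by (rule ptI[OF polytime_Node[OF F(1) G(1)]]) (simp add: F G e_pair_def)
qed

lemma pt_fst: "pt e (e_pair a b) f \<Longrightarrow> pt e a (\<lambda>x. fst (f x))"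
  by (rule pt_comp[of "e_pair a b"], rule ptI[OF polytime_dfst[OF polytime_id]])
    (simp_all add: e_pair_def)

lemma pt_snd: "pt e (e_pair a b) f \<Longrightarrow> pt e b (\<lambda>x. snd (f x))"
  by (rule pt_comp[of "e_pair a b"], rule ptI[OF polytime_dsnd[OF polytime_id]])
    (simp_all add: e_pair_def)

text \<open>With \<open>f\<close> instantiated, the conclusion matches exactly the calls of
  \<open>f\<close>, which makes it a syntax-directed rule.\<close>

lemma pt_call2:
  assumes "pt (e_pair a b) r (\<lambda>z. f (fst z) (snd z))" "pt e a g" "pt e b h"
  shows "pt e r (\<lambda>x. f (g x) (h x))"
  using pt_comp[OF assms(1) pt_Pair[OF assms(2,3)]] by simp

lemma pt_call3:
  assumes "pt (e_pair a (e_pair b c)) r (\<lambda>z. f (fst z) (fst (snd z)) (snd (snd z)))"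
    and "pt e a g" "pt e b h" "pt e c k"
  shows "pt e r (\<lambda>x. f (g x) (h x) (k x))"
  using pt_comp[OF assms(1) pt_Pair[OF assms(2) pt_Pair[OF assms(3,4)]]] by simp

lemma pt_call4:
  assumes "pt (e_pair a (e_pair b (e_pair c d))) r
      (\<lambda>z. f (fst z) (fst (snd z)) (fst (snd (snd z))) (snd (snd (snd z))))"
    and "pt e a g" "pt e b h" "pt e c k" "pt e d l"
  shows "pt e r (\<lambda>x. f (g x) (h x) (k x) (l x))"
  using pt_comp[OF assms(1) pt_Pair[OF assms(2) pt_Pair[OF assms(3) pt_Pair[OF assms(4,5)]]]] by simp

lemma pt_if:
  assumes "pt e e_bool c" "pt e a f" "pt e a g"
  shows "pt e a (\<lambda>x. if c x then f x else g x)"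
proof -
  obtain C where C: "polytime C" "\<And>x. C (e x) = e_bool (c x)" using assms(1) by (rule ptE) blast
  obtain F where F: "polytime F" "\<And>x. F (e x) = a (f x)" using assms(2) by (rule ptE) blast
  obtain G where G: "polytime G" "\<And>x. G (e x) = a (g x)" using assms(3) by (rule ptE) blast
  show ?thesis by (rule ptI[OF polytime_if[OF C(1) F(1) G(1)]]) (simp add: C F G e_bool_def)
qed

lemma pt_not:
  assumes "pt e e_bool f"
  shows "pt e e_bool (\<lambda>x. \<not> f x)"
proof -
  have *: "(\<lambda>x. \<not> f x) = (\<lambda>x. if f x then False else True)" by auto
  show ?thesis unfolding * by (rule pt_if[OF assms pt_const pt_const])
qed

lemma pt_conj:
  assumes "pt e e_bool f" "pt e e_bool g"
  shows "pt e e_bool (\<lambda>x. f x \<and> g x)"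
proof -
  have *: "(\<lambda>x. f x \<and> g x) = (\<lambda>x. if f x then g x else False)" by auto
  show ?thesis unfolding * by (rule pt_if[OF assms pt_const])
qed

lemma pt_disj:
  assumes "pt e e_bool f" "pt e e_bool g"
  shows "pt e e_bool (\<lambda>x. f x \<or> g x)"
proof -
  have *: "(\<lambda>x. f x \<or> g x) = (\<lambda>x. if f x then True else g x)" by auto
  show ?thesis unfolding * by (rule pt_if[OF assms(1) pt_const assms(2)])
qed

lemma pt_eq:
  assumes "pt e a f" "pt e a g" "inj a"
  shows "pt e e_bool (\<lambda>x. f x = g x)"
proof -
  obtain F where F: "polytime F" "\<And>x. F (e x) = a (f x)" using assms(1) by (rule ptE) blast
  obtain G where G: "polytime G" "\<And>x. G (e x) = a (g x)" using assms(2) by (rule ptE) blast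
  show ?thesis
    by (rule ptI[OF polytime_eq[OF F(1) G(1)]]) (simp add: F G e_bool_def inj_eq[OF assms(3)])
qed

lemma pt_Cons:
  assumes "pt e a f" "pt e (e_list a) g"
  shows "pt e (e_list a) (\<lambda>x. f x # g x)"
proof -
  obtain F where F: "polytime F" "\<And>x. F (e x) = a (f x)" using assms(1) by (rule ptE) blast
  obtain G where G: "polytime G" "\<And>x. G (e x) = e_list a (g x)" using assms(2) by (rule ptE) blast
  show ?thesis by (rule ptI[OF polytime_Node[OF F(1) G(1)]]) (simp add: F G)
qed

lemma pt_append:
  assumes "pt e (e_list a) f" "pt e (e_list a) g"
  shows "pt e (e_list a) (\<lambda>x. f x @ g x)"
proof -
  obtain F where F: "polytime F" "\<And>x. F (e x) = e_list a (f x)" using assms(1) by (rule ptE) blast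
  obtain G where G: "polytime G" "\<And>x. G (e x) = e_list a (g x)" using assms(2) by (rule ptE) blast
  show ?thesis
    by (rule ptI[OF polytime_append[OF F(1) G(1)]]) (simp add: F G, simp add: e_list_def)
qed

lemma pt_rev:
  assumes "pt e (e_list a) f"
  shows "pt e (e_list a) (\<lambda>x. rev (f x))"
proof -
  obtain F where F: "polytime F" "\<And>x. F (e x) = e_list a (f x)" using assms(1) by (rule ptE) blast
  show ?thesis
    by (rule ptI[OF polytime_drevapp[OF F(1) polytime_Leaf]])
      (simp add: F drevapp_def, simp add: e_list_def rev_map)
qed

lemma pt_tl:
  assumes "pt e (e_list a) f"
  shows "pt e (e_list a) (\<lambda>x. tl (f x))"
proof (rule pt_comp[OF _ assms], rule ptI[OF polytime_dsnd[OF polytime_id]])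
  show "dsnd (e_list a xs) = e_list a (tl xs)" for xs by (cases xs) auto
qed

text \<open>A branch may mention \<open>x\<close> as well as the bound variables, so the environment
  is paired with head and tail; maps and filters treat it likewise.\<close>

lemma pt_case_list:
  assumes "pt e (e_list a) g" "pt e b f"
    and "pt (e_pair e (e_pair a (e_list a))) b (\<lambda>z. h (fst z) (fst (snd z)) (snd (snd z)))"
  shows "pt e b (\<lambda>x. case g x of [] \<Rightarrow> f x | y # ys \<Rightarrow> h x y ys)"
proof -
  obtain G where G: "polytime G" "\<And>x. G (e x) = e_list a (g x)" using assms(1) by (rule ptE) blast
  obtain F where F: "polytime F" "\<And>x. F (e x) = b (f x)" using assms(2) by (rule ptE) blast
  obtain H where H: "polytime H" "\<And>x y ys. H (Node (e x) (Node (a y) (e_list a ys))) = b (h x y ys)"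
    using assms(3) by (rule ptE) (force simp: e_pair_def)
  have "polytime (\<lambda>d. if G d = Leaf then F d else H (Node d (G d)))"
    by (intro polytime_if_eq polytime_comp[OF H(1)] polytime_Node G F polytime_id polytime_Leaf)
  then show ?thesis by (rule ptI) (auto simp: F G H split: list.split)
qed

lemma pt_null:
  assumes "pt e (e_list a) f"
  shows "pt e e_bool (\<lambda>x. f x = [])"
proof -
  have *: "(\<lambda>x. f x = []) = (\<lambda>x. case f x of [] \<Rightarrow> True | y # ys \<Rightarrow> False)"
    by (rule ext) (simp split: list.split)
  show ?thesis unfolding * by (rule pt_case_list[OF assms pt_const pt_const])
qed

lemma pt_concat_map:
  assumes "pt e (e_list a) g" "pt (e_pair e a) (e_list b) (\<lambda>z. f (fst z) (snd z))"
  shows "pt e (e_list b) (\<lambda>x. concat (map (f x) (g x)))"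
proof -
  obtain G where G: "polytime G" "\<And>x. G (e x) = e_list a (g x)" using assms(1) by (rule ptE) blast
  obtain F where F: "polytime F" "\<And>x y. F (Node (e x) (a y)) = e_list b (f x y)"
    using assms(2) by (rule ptE) (force simp: e_pair_def)
  have "polytime (\<lambda>d. enc_list (concat (map (\<lambda>x. dl (F (Node d x))) (dl (G d)))))"
    using polytime_comp[OF polytime_concat_map[OF F(1)] polytime_Node[OF polytime_id G(1)]] by simp
  then show ?thesis
    by (rule ptI) (simp add: G F comp_def, simp add: e_list_def map_concat comp_def)
qed

lemma pt_map:
  assumes "pt e (e_list a) g" "pt (e_pair e a) b (\<lambda>z. f (fst z) (snd z))"
  shows "pt e (e_list b) (\<lambda>x. map (f x) (g x))"
  using pt_concat_map[OF assms(1) pt_Cons[OF assms(2) pt_const[of _ _ "[]"]]] by simp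

lemma pt_filter:
  assumes "pt e (e_list a) g" "pt (e_pair e a) e_bool (\<lambda>z. P (fst z) (snd z))"
  shows "pt e (e_list a) (\<lambda>x. filter (P x) (g x))"
proof -
  have "pt e (e_list a) (\<lambda>x. concat (map (\<lambda>y. if P x y then [y] else []) (g x)))"
    by (rule pt_concat_map[OF assms(1)]) (rule pt_if assms(2) pt_Cons pt_const[of _ _ "[]"] pt_snd[OF pt_id])+
  moreover have "concat (map (\<lambda>y. if P x y then [y] else []) ys) = filter (P x) ys" for x ys
    by (induction ys) auto
  ultimately show ?thesis by simp
qed

lemma pt_Bex:
  assumes "pt e (e_list a) g" "pt (e_pair e a) e_bool (\<lambda>z. P (fst z) (snd z))"
  shows "pt e e_bool (\<lambda>x. \<exists>y\<in>set (g x). P x y)"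
  using pt_not[OF pt_null[OF pt_filter[OF assms]]] by (simp add: filter_empty_conv)

lemma pt_Ball:
  assumes "pt e (e_list a) g" "pt (e_pair e a) e_bool (\<lambda>z. P (fst z) (snd z))"
  shows "pt e e_bool (\<lambda>x. \<forall>y\<in>set (g x). P x y)"
  using pt_null[OF pt_filter[OF assms(1) pt_not[OF assms(2)]]] by (simp add: filter_empty_conv)

lemma pt_member:
  assumes "pt e a f" "pt e (e_list a) g" "inj a"
  shows "pt e e_bool (\<lambda>x. f x \<in> set (g x))"
proof -
  have "pt e e_bool (\<lambda>x. \<exists>y\<in>set (g x). f x = y)"
    by (rule pt_Bex[OF assms(2)] pt_eq[OF _ _ assms(3)] pt_comp[OF assms(1)]
        pt_fst[OF pt_id] pt_snd[OF pt_id])+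
  then show ?thesis by simp
qed

lemma pt_fold:
  assumes "polytime (\<lambda>d. F (dfst d) (dsnd d))" "\<And>x s. size (F x s) \<le> size s + c * Suc (size x)"
    and F: "\<And>x s. F (a x) (b s) = b (f x s)" and "pt e (e_list a) g" "pt e b h"
  shows "pt e b (\<lambda>x. fold f (g x) (h x))"
proof (rule pt_call2[OF _ assms(4,5)], rule ptI[OF polytime_fold_additive[OF assms(1,2)]])
  have "fold F (map a xs) (b s) = b (fold f xs s)" for xs s
    by (induction xs arbitrary: s) (auto simp: F)
  then show "fold F (dl (dfst (e_pair (e_list a) b z))) (dsnd (e_pair (e_list a) b z))
      = b (fold f (fst z) (snd z))" for z
    by (simp add: e_pair_def)
qed

lemma pt_tails:
  assumes "pt e (e_list a) f"
  shows "pt e (e_list (e_list a)) (\<lambda>x. tails (f x))"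
proof -
  \<comment> \<open>The state holds the current suffix and the list of all suffixes so far. Each
    round adds copies of the current suffix, so the growth is quadratic and
    \<open>polytime_fold_additive\<close> does not apply.\<close>
  let ?f = "\<lambda>x s. Node (Node x (dfst s)) (Node (Node x (dfst s)) (dsnd s))"
  have sz: "size (fold ?f xs s) \<le> 1 + size (dfst s) + size (dsnd s)
      + size (enc_list xs) * (size (dfst s) + size (enc_list xs) + 2)" for xs s
  proof (induction xs arbitrary: s)
    case Nil
    show ?case by (cases s) auto
  next
    case (Cons x xs)
    let ?c = "size (dfst s)" and ?n = "size x" and ?m = "size (enc_list xs)"
    have "size (fold ?f (x # xs) s) \<le> 1 + (?c + ?n + 1) + (?c + ?n + 1 + size (dsnd s) + 1)
        + ?m * (?c + ?n + 1 + ?m + 2)"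
      using Cons.IH[of "?f x s"] by (simp add: algebra_simps)
    also have "\<dots> \<le> 1 + ?c + size (dsnd s) + (?n + 1) * (?c + ?n + 1 + ?m + 2)
        + ?m * (?c + ?n + 1 + ?m + 2)" by (simp add: algebra_simps)
    finally show ?case by (simp add: algebra_simps)
  qed
  have "polytime (\<lambda>d. fold ?f (dl (dfst d)) (dsnd d))"
  proof (rule polytime_fold[where q = "\<lambda>n. 1 + n + n * (n + 2)"])
    show "polytime (\<lambda>d. ?f (dfst d) (dsnd d))"
      by (intro polytime_Node polytime_dfst polytime_dsnd polytime_id)
    show "size (fold ?f xs s) \<le> 1 + (size (enc_list xs) + size s)
        + (size (enc_list xs) + size s) * (size (enc_list xs) + size s + 2)" for xs s
    proof -
      have "size (dfst s) + size (dsnd s) \<le> size s" by (cases s) auto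
      moreover from this have "size (enc_list xs) * (size (dfst s) + size (enc_list xs) + 2)
          \<le> (size (enc_list xs) + size s) * (size (enc_list xs) + size s + 2)"
        by (intro mult_le_mono) auto
      ultimately show ?thesis using sz[of xs s] by linarith
    qed
  qed (intro ispoly.intros)
  from polytime_dsnd[OF polytime_comp[OF this polytime_Node[OF polytime_id polytime_Leaf]]]
  have p: "polytime (\<lambda>d. dsnd (fold ?f (dl d) Leaf))" by simp
  have "fold ?f (map a (rev xs)) Leaf = (if xs = [] then Leaf else Node (e_list a xs) (e_list (e_list a) (tails xs)))" for xs
    by (induction xs) auto
  then have "dsnd (fold ?f (dl (e_list a (rev xs))) Leaf) = e_list (e_list a) (tails xs)" for xs
    by simp
  from pt_comp[OF ptI[OF p], of "e_list a" "e_list (e_list a)" "\<lambda>xs. tails (rev xs)", OF _ pt_rev[OF assms]] this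
  show ?thesis by (metis (no_types, lifting) ext rev_rev_ident)
qed

text \<open>Depth-first traversal with an explicit stack. As \<open>K\<close> does not increase the
  size, replacing an entry by its children removes at least its list cell, so the size of the stack
  bounds the rounds. Visited nodes pile up in front, hence the reversal.\<close>

lemma pt_worklist:
  assumes kids: "pt a (e_list a) kids" and "polytime K" "\<And>d. size (K d) \<le> size d"
    and K: "\<And>x. K (a x) = e_list a (kids x)" and pre: "\<And>x. pre x = x # concat (map pre (kids x))"
  shows "pt a (e_list a) (\<lambda>x. rev (pre x))"
proof -
  let ?f = "\<lambda>s. Node (enc_list (dl (K (dfst (dfst s))) @ dl (dsnd (dfst s)))) (Node (dfst (dfst s)) (dsnd s))"
  let ?w = "while (\<lambda>s. dfst s \<noteq> Leaf) ?f"
  let ?N = "\<lambda>s. size (dfst s) + 1"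
  \<comment> \<open>An amortized bound: a round adds at most \<open>?N s\<close> to the output while
    the worklist shrinks by at least 1.\<close>
  let ?I = "\<lambda>s t. size (dfst t) \<le> size (dfst s) \<and>
    size (dsnd t) + size (dfst t) * ?N s \<le> size (dsnd s) + size (dfst s) * ?N s"
  have dec: "size (dfst (?f s)) < size (dfst s)"
    "size (dsnd (?f s)) \<le> size (dsnd s) + size (dfst s) + 1" if "dfst s \<noteq> Leaf" for s
    using that assms(3)[of "dfst (dfst s)"]
    by (cases "dfst s"; simp add: size_enc_list_append)+
  have "polytime ?w"
  proof (rule polytime_while[where q = "\<lambda>n. 1 + n + n + n * (n + 1)" and \<mu> = "\<lambda>s. size (dfst s)" and I = ?I])
    show "polytime ?f"
      by (intro polytime_Node polytime_append polytime_comp[OF assms(2)] polytime_dfst polytime_dsnd polytime_id)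
    show "ispoly (\<lambda>n. 1 + n + n + n * (n + 1))" by (intro ispoly.intros)
    show "size (dfst (?f s)) < size (dfst s)" if "dfst s \<noteq> Leaf" for s by (rule dec(1)[OF that])
    show "size (dfst s) \<le> 1 + size s + size s + size s * (size s + 1)" for s
      using size_dfst[of s] by simp
    show "?I s (?f t)" if "?I s t" "dfst t \<noteq> Leaf" for s t
    proof
      show "size (dfst (?f t)) \<le> size (dfst s)" using dec(1)[OF that(2)] that(1) by linarith
      have "Suc (size (dfst (?f t))) * ?N s \<le> size (dfst t) * ?N s"
        using dec(1)[OF that(2)] by (intro mult_le_mono1) simp
      moreover have "size (dsnd (?f t)) \<le> size (dsnd t) + ?N s"
        using dec(2)[OF that(2)] that(1) by linarith
      ultimately show "size (dsnd (?f t)) + size (dfst (?f t)) * ?N s \<le> size (dsnd s) + size (dfst s) * ?N s"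
        using that(1) by (simp only: mult_Suc) linarith
    qed
    show "size t \<le> 1 + size s + size s + size s * (size s + 1)" if "?I s t" for s t
    proof -
      have "size t \<le> 1 + size (dfst t) + size (dsnd t)" by (cases t) auto
      also have "\<dots> \<le> 1 + size (dfst s) + (size (dsnd s) + size (dfst s) * ?N s)"
        using that by linarith
      also have "size (dfst s) * ?N s \<le> size s * (size s + 1)"
        using size_dfst[of s] by (intro mult_le_mono) auto
      finally show ?thesis using size_dfst[of s] size_dsnd[of s] by linarith
    qed
  qed (auto intro!: polytime_id polytime_dfst)
  from polytime_dsnd[OF polytime_comp[OF this, of "\<lambda>d. Node (Node d Leaf) Leaf"]]
  have p: "polytime (\<lambda>d. dsnd (?w (Node (Node d Leaf) Leaf)))"
    by (simp add: polytime_Node polytime_Leaf polytime_id)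
  have "?w (Node (e_list a xs) s) = Node Leaf (enc_list (rev (map a (concat (map pre xs))) @ dl s))" for xs s
  proof (induction "size (e_list a xs)" arbitrary: xs s rule: less_induct)
    case less
    show ?case
    proof (cases xs)
      case Nil
      then show ?thesis by (subst while_unfold) simp
    next
      case (Cons x ys)
      have app: "enc_list (map a us @ map a vs) = e_list a (us @ vs)" for us vs
        by (simp add: e_list_def)
      have "size (e_list a (kids x @ ys)) = size (e_list a (kids x)) + size (e_list a ys)"
        by (simp add: e_list_def size_enc_list_append)
      then have "size (e_list a (kids x @ ys)) < size (e_list a xs)"
        using assms(3)[of "a x"] by (simp add: Cons K)
      from less[OF this] have "?w (Node (e_list a (kids x @ ys)) (Node (a x) s)) =
          Node Leaf (enc_list (rev (map a (concat (map pre (kids x @ ys)))) @ a x # dl s))" by simp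
      then show ?thesis by (subst while_unfold) (simp add: Cons K app pre[of x])
    qed
  qed
  from this[of "[_]" Leaf] show ?thesis by (intro ptI[OF p]) (simp, simp add: e_list_def rev_map)
qed

section \<open>Injectivity of the encodings\<close>

lemma enc_nat_0 [simp]: "enc_nat 0 = Leaf"
  by (simp add: enc_nat.simps)

lemma enc_nat_1: "enc_nat 1 = Node (Node Leaf Leaf) Leaf"
  by (simp add: enc_nat.simps)

lemma enc_nat_2: "enc_nat 2 = Node Leaf (Node (Node Leaf Leaf) Leaf)"
  by (simp add: enc_nat.simps)

lemma inj_enc_nat: "inj enc_nat"
proof (rule injI)
  show "enc_nat m = enc_nat n \<Longrightarrow> m = n" for m n
  proof (induction m arbitrary: n rule: less_induct)
    case (less m)
    show ?case
    proof (cases "m = 0 \<or> n = 0")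
      case True
      then show ?thesis using less.prems
        by (auto simp: enc_nat.simps[of m] enc_nat.simps[of n] split: if_splits)
    next
      case False
      then have "enc_nat (m div 2) = enc_nat (n div 2)" "even m = even n"
        using less.prems by (auto simp: enc_nat.simps[of m] enc_nat.simps[of n] split: if_splits)
      with less.IH[of "m div 2" "n div 2"] False show ?thesis
        by (metis bit_eq_rec div_less_dividend neq0_conv one_less_numeral_iff semiring_norm(76))
    qed
  qed
qed

lemma inj_enc_lit: "inj enc_lit"
proof (rule injI)
  show "enc_lit p = enc_lit q \<Longrightarrow> p = q" for p q
    by (cases p; cases q) (auto simp: enc_nat_1[simplified] inj_eq[OF inj_enc_nat])
qed

lemma inj_e_bool: "inj e_bool"
  by (rule injI) (auto simp: e_bool_def split: if_splits)

lemma inj_e_list: "inj a \<Longrightarrow> inj (e_list a)"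
proof (rule injI)
  show "inj a \<Longrightarrow> e_list a xs = e_list a ys \<Longrightarrow> xs = ys" for xs ys
    by (metis e_list_simps(3) inj_map_eq_map)
qed

fun e_instr :: "instr \<Rightarrow> data" where
  "e_instr Push = Leaf"
| "e_instr Unary = Node Leaf Leaf"
| "e_instr (Binary b) = Node (e_bool b) (Node Leaf Leaf)"
| "e_instr Nip = Node Leaf (Node Leaf (Node Leaf Leaf))"
| "e_instr Swap = Node Leaf (Node (Node Leaf Leaf) Leaf)"

lemma inj_e_instr: "inj e_instr"
proof (rule injI)
  show "e_instr x = e_instr y \<Longrightarrow> x = y" for x y
    by (cases x; cases y) (auto simp: inj_eq[OF inj_e_bool])
qed

lemma pt_Binary:
  assumes "pt e e_bool f"
  shows "pt e e_instr (\<lambda>x. Binary (f x))"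
proof -
  have *: "(\<lambda>x. Binary (f x)) = (\<lambda>x. if f x then Binary True else Binary False)" by auto
  show ?thesis unfolding * by (rule pt_if[OF assms pt_const pt_const])
qed

section \<open>The translations run in polynomial time\<close>

abbreviation e_item :: "item \<Rightarrow> data" where
  "e_item \<equiv> e_pair e_bool (e_pair e_bool (e_list enc_lit))"

abbreviation e_code :: "code \<Rightarrow> data" where
  "e_code \<equiv> e_list (e_pair e_instr (e_list e_item))"

text \<open>The conclusion of \<open>pt_comp\<close> unifies with every goal, hence it is not among the rules.\<close>

lemmas pt_rules = pt_const pt_fst pt_snd pt_Pair pt_if pt_not pt_conj pt_disj pt_null
  pt_eq pt_Cons pt_append pt_rev pt_tl pt_case_list pt_concat_map pt_map pt_filter pt_Bex pt_Ball
  pt_member pt_tails pt_Binary pt_id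
  inj_enc_lit inj_e_bool inj_e_list[OF inj_enc_lit] inj_e_instr

lemma pt_neg: "pt e enc_lit f \<Longrightarrow> pt e enc_lit (\<lambda>x. neg (f x))"
proof (rule pt_comp[where f = neg])
  let ?F = "\<lambda>d. if dfst d = Leaf then Node (enc_nat 1) (dsnd d) else Node Leaf (dsnd d)"
  have "polytime ?F"
    by (intro polytime_if_eq polytime_Node polytime_dfst polytime_dsnd polytime_const polytime_id)
  moreover have "?F (enc_lit p) = enc_lit (neg p)" for p
    by (cases p) (simp_all add: enc_nat_1[simplified])
  ultimately show "pt enc_lit enc_lit neg" by (rule ptI)
qed

text \<open>The pattern for the functions below: the body is analysed by syntax-directed rules, and
  the result becomes a rule for calls.\<close>

lemma pt_neg_item0: "pt e_item e_item (\<lambda>z. neg_item z)"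
  unfolding neg_item_def[abs_def] by (rule pt_rules)+

lemmas pt_neg_item = pt_comp[where f = neg_item, OF pt_neg_item0]

lemma pt_lit_item0: "pt (e_pair e_bool enc_lit) e_item
    (\<lambda>z. lit_item (fst z) (snd z))"
  unfolding lit_item_def[abs_def] by (rule pt_rules)+

lemmas pt_lit_item = pt_call2[where f = lit_item, OF pt_lit_item0]

lemma pt_alpha0: "pt e_item e_bool (\<lambda>z. alpha z)"
  unfolding alpha_def[abs_def] by (rule pt_rules)+

lemmas pt_alpha = pt_comp[where f = alpha, OF pt_alpha0]

lemma pt_beta0: "pt e_item e_bool (\<lambda>z. beta z)"
  unfolding beta_def[abs_def] by (rule pt_rules)+

lemmas pt_beta = pt_comp[where f = beta, OF pt_beta0]

lemma pt_supports0: "pt (e_pair e_bool (e_pair enc_lit e_item)) e_bool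
    (\<lambda>z. supports (fst z) (fst (snd z)) (snd (snd z)))"
  unfolding supports_def[abs_def] by (rule pt_rules pt_alpha)+

lemmas pt_supports = pt_call3[where f = supports, OF pt_supports0]

lemma pt_witnesses0: "pt (e_list e_item) (e_list e_item) (\<lambda>z. witnesses z)"
  unfolding witnesses_def[abs_def] by (rule pt_rules pt_beta pt_supports)+

lemmas pt_witnesses = pt_comp[where f = witnesses, OF pt_witnesses0]

lemma pt_closed0: "pt (e_list e_item) e_bool (\<lambda>z. closed z)"
  unfolding closed_def[abs_def] by (rule pt_rules pt_witnesses)+

lemmas pt_closed = pt_comp[where f = closed, OF pt_closed0]

lemma pt_weakc0: "pt (e_pair (e_list e_item) (e_list e_item)) e_code
    (\<lambda>z. weakc (fst z) (snd z))"
  unfolding weakc_def[abs_def] by (rule pt_rules)+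

lemmas pt_weakc = pt_call2[where f = weakc, OF pt_weakc0]

lemma pt_cutc0: "pt (e_pair e_item (e_list e_item)) e_code
    (\<lambda>z. cutc (fst z) (snd z))"
  unfolding cutc_def[abs_def] by (rule pt_rules)+

lemmas pt_cutc = pt_call2[where f = cutc, OF pt_cutc0]

lemma pt_alpha_step0: "pt (e_pair e_bool (e_pair e_bool (e_pair enc_lit (e_list enc_lit)))) e_code
    (\<lambda>z. alpha_step (fst z) (fst (snd z)) (fst (snd (snd z))) (snd (snd (snd z))))"
  unfolding alpha_step_def[abs_def] by (rule pt_rules pt_lit_item)+

lemmas pt_alpha_step = pt_call4[where f = alpha_step, OF pt_alpha_step0]

lemma pt_alpha_code0: "pt (e_pair e_bool (e_pair e_bool (e_pair (e_list enc_lit) enc_lit))) e_code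
    (\<lambda>z. alpha_code (fst z) (fst (snd z)) (fst (snd (snd z))) (snd (snd (snd z))))"
  unfolding alpha_code_def[abs_def] by (rule pt_rules pt_alpha_step)+

lemmas pt_alpha_code = pt_call4[where f = alpha_code, OF pt_alpha_code0]

lemma pt_lit_code0: "pt (e_pair e_bool (e_pair enc_lit (e_list e_item))) e_code
    (\<lambda>z. lit_code (fst z) (fst (snd z)) (snd (snd z)))"
  unfolding lit_code_def[abs_def] by (rule pt_rules pt_supports pt_alpha_code pt_weakc pt_lit_item)+

lemmas pt_lit_code = pt_call3[where f = lit_code, OF pt_lit_code0]

lemma pt_beta_step0: "pt (e_pair (e_list e_item) (e_pair e_bool (e_pair e_bool (e_list enc_lit)))) e_code
    (\<lambda>z. beta_step (fst z) (fst (snd z)) (fst (snd (snd z))) (snd (snd (snd z))))"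
  unfolding beta_step_def[abs_def] by (rule pt_rules pt_lit_code pt_lit_item)+

lemmas pt_beta_step = pt_call4[where f = beta_step, OF pt_beta_step0]

lemma pt_beta_code0: "pt (e_pair (e_list e_item) (e_pair e_bool (e_pair e_bool (e_list enc_lit)))) e_code
    (\<lambda>z. beta_code (fst z) (fst (snd z)) (fst (snd (snd z))) (snd (snd (snd z))))"
  unfolding beta_code_def[abs_def] by (rule pt_rules pt_beta_step)+

lemmas pt_beta_code = pt_call4[where f = beta_code, OF pt_beta_code0]

lemma pt_closed_code0: "pt (e_list e_item) e_code (\<lambda>z. closed_code z)"
  unfolding closed_code_def[abs_def] by (rule pt_rules pt_witnesses pt_beta_code)+

lemmas pt_closed_code = pt_comp[where f = closed_code, OF pt_closed_code0]

lemma pt_keep0: "pt (e_pair (e_list e_item) (e_list e_item)) (e_list e_item)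
    (\<lambda>z. keep (fst z) (snd z))"
  unfolding keep_def[abs_def] by (rule pt_rules pt_closed pt_neg_item)+

lemmas pt_keep = pt_call2[where f = keep, OF pt_keep0]

lemma pt_absorb_step0: "pt (e_pair (e_list e_item) (e_list e_item)) e_code
    (\<lambda>z. absorb_step (fst z) (snd z))"
  unfolding absorb_step_def[abs_def] by (rule pt_rules pt_closed_code pt_cutc pt_neg_item)+

lemmas pt_absorb_step = pt_call2[where f = absorb_step, OF pt_absorb_step0]

lemma pt_absorb0: "pt (e_pair (e_list e_item) (e_list e_item)) e_code
    (\<lambda>z. absorb (fst z) (snd z))"
  unfolding absorb_def[abs_def] by (rule pt_rules pt_weakc pt_absorb_step pt_keep pt_closed pt_neg_item)+

lemmas pt_absorb = pt_call2[where f = absorb, OF pt_absorb0]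

lemma pt_combine0: "pt (e_pair (e_list e_item) (e_pair e_item e_item)) e_code
    (\<lambda>z. combine (fst z) (fst (snd z)) (snd (snd z)))"
  unfolding combine_def[abs_def] by (rule pt_rules pt_closed_code pt_cutc pt_neg_item)+

lemmas pt_combine = pt_call3[where f = combine, OF pt_combine0]

lemma pt_initial0: "pt (e_list e_item) e_bool (\<lambda>z. initial z)"
  unfolding initial_def[abs_def] by (rule pt_rules pt_neg)+

lemmas pt_initial = pt_comp[where f = initial, OF pt_initial0]

lemma pt_units0: "pt (e_pair (e_list e_item) (e_list (e_list e_item))) (e_list e_item)
    (\<lambda>z. units (fst z) (snd z))"
  unfolding units_def[abs_def] by (rule pt_rules pt_keep)+

lemmas pt_units = pt_call2[where f = units, OF pt_units0]

lemma pt_dag_node0: "pt (e_pair (e_list e_item) (e_list (e_list e_item))) e_code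
    (\<lambda>z. dag_node (fst z) (snd z))"
  unfolding dag_node_def[abs_def] by (rule pt_rules pt_initial pt_absorb pt_units pt_closed pt_neg_item pt_combine pt_lit_item pt_cutc)+

lemmas pt_dag_node = pt_call2[where f = dag_node, OF pt_dag_node0]

lemma pt_dag_code0: "pt (e_list (e_list e_item)) e_code (\<lambda>z. dag_code z)"
  unfolding dag_code_def[abs_def] by (rule pt_rules pt_dag_node)+

lemmas pt_dag_code = pt_comp[where f = dag_code, OF pt_dag_code0]

lemma pt_tree_node0: "pt (e_pair (e_list e_item) (e_list (e_list e_item))) e_code
    (\<lambda>z. tree_node (fst z) (snd z))"
  unfolding tree_node_def[abs_def] by (rule pt_rules pt_absorb pt_keep pt_combine)+

lemmas pt_tree_node = pt_call2[where f = tree_node, OF pt_tree_node0]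

lemma pt_lines0: "pt e_code (e_list (e_list e_item)) (\<lambda>z. lines z)"
  unfolding lines_def[abs_def] by (rule pt_rules)+

lemmas pt_lines = pt_comp[where f = lines, OF pt_lines0]

section \<open>Reading and writing formulas, sequents and trees\<close>

primrec bf_kids :: "bf \<Rightarrow> bf list" where
  "bf_kids (BLit p) = []"
| "bf_kids (And A B) = [A, B]"
| "bf_kids (Or A B) = [A, B]"

lemma pt_subforms: "pt enc_bf (e_list enc_bf) (\<lambda>A. rev (subforms A))"
proof (rule pt_worklist[where kids = bf_kids])
  let ?K = "\<lambda>d. if dfst d = Leaf then Leaf else Node (dfst (dsnd d)) (Node (dsnd (dsnd d)) Leaf)"
  show K: "polytime ?K"
    by (intro polytime_if_eq polytime_Node polytime_dfst polytime_dsnd polytime_const polytime_id)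
  show *: "?K (enc_bf A) = e_list enc_bf (bf_kids A)" for A
    by (cases A) (simp_all add: enc_nat_1[simplified] enc_nat_2)
  show "pt enc_bf (e_list enc_bf) bf_kids" using K * by (rule ptI)
  \<comment> \<open>A tag other than \<open>Leaf\<close> pays for the additional list cell, even if
    \<open>d\<close> encodes no formula.\<close>
  show "size (?K d) \<le> size d" for d
  proof (cases d)
    case (Node x y)
    then show ?thesis by (cases x; cases y) auto
  qed simp
  show "subforms A = A # concat (map subforms (bf_kids A))" for A by (cases A) auto
qed

lemma pt_bf_lits: "pt e enc_bf f \<Longrightarrow> pt e (e_list enc_lit) (\<lambda>x. bf_lits (f x))"
proof (rule pt_comp[where f = bf_lits])
  let ?f = "\<lambda>B. case B of BLit p \<Rightarrow> [p] | _ \<Rightarrow> []"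
  have "pt enc_bf (e_list enc_lit) ?f"
  proof (rule ptI)
    let ?F = "\<lambda>d. if dfst d = Leaf then Node (dsnd d) Leaf else Leaf"
    show "polytime ?F"
      by (intro polytime_if_eq polytime_Node polytime_dfst polytime_dsnd polytime_const polytime_id)
    show "?F (enc_bf A) = e_list enc_lit (?f A)" for A
      by (cases A) (simp_all add: enc_nat_1[simplified] enc_nat_2)
  qed
  then have "pt enc_bf (e_list enc_lit) (\<lambda>A. concat (map ?f (rev (rev (subforms A)))))"
    by (rule pt_concat_map[OF pt_rev[OF pt_subforms] pt_comp[where f = ?f, OF _ pt_snd[OF pt_id]]])
  then show "pt enc_bf (e_list enc_lit) bf_lits" by (simp add: bf_lits_def[abs_def])
qed

lemma pt_is_disj: "pt e enc_bf f \<Longrightarrow> pt e e_bool (\<lambda>x. is_disj (f x))"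
proof (rule pt_comp[where f = is_disj])
  let ?F = "\<lambda>d. if dfst d = enc_nat 2 then Node Leaf Leaf else Leaf"
  have "polytime ?F"
    by (intro polytime_if_eq polytime_dfst polytime_const polytime_id)
  moreover have "?F (enc_bf A) = e_bool (is_disj A)" for A
    by (cases A) (simp_all add: enc_nat_1[simplified] enc_nat_2 is_disj_def e_bool_def)
  ultimately show "pt enc_bf e_bool is_disj" by (rule ptI)
qed

lemma pt_item_of: "pt e e_bool f \<Longrightarrow> pt e enc_bf g \<Longrightarrow> pt e e_item (\<lambda>x. item_of (f x) (g x))"
  unfolding item_of_def by (rule pt_rules pt_is_disj pt_bf_lits | assumption)+

lemma enc_seq_eq: "enc_seq a = e_pair (e_list a) (e_list a)"
  by (rule ext) (simp add: enc_seq_def e_pair_def e_list_def)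

lemma pt_items_of: "pt e (enc_seq enc_bf) f \<Longrightarrow> pt e (e_list e_item) (\<lambda>x. items_of (f x))"
  unfolding items_of_def enc_seq_eq by (rule pt_rules pt_item_of | assumption)+

lemma pt_DLit: "pt e enc_lit f \<Longrightarrow> pt e enc_dt (\<lambda>x. DLit (f x))"
  by (rule pt_comp[where f = DLit], rule ptI[OF polytime_Node[OF polytime_Leaf polytime_id]]) simp_all

lemma pt_fold_Dec:
  "pt e (e_list enc_lit) g \<Longrightarrow> pt e enc_dt h \<Longrightarrow>
    pt e enc_dt (\<lambda>x. fold (\<lambda>q A. Dec A q (DLit q)) (g x) (h x))"
  "pt e (e_list enc_lit) g \<Longrightarrow> pt e enc_dt h \<Longrightarrow>
    pt e enc_dt (\<lambda>x. fold (\<lambda>q A. Dec (DLit q) q A) (g x) (h x))"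
proof -
  show "pt e (e_list enc_lit) g \<Longrightarrow> pt e enc_dt h \<Longrightarrow>
      pt e enc_dt (\<lambda>x. fold (\<lambda>q A. Dec A q (DLit q)) (g x) (h x))"
    \<comment> \<open>A step adds \<open>6 + 2 * size q\<close>, so 10 is a generous
      constant.\<close>
    by (rule pt_fold[where F = "\<lambda>q A. Node (enc_nat 1) (Node A (Node q (Node Leaf q)))" and c = 10])
      (intro polytime_Node polytime_dfst polytime_dsnd polytime_const polytime_id,
        simp_all add: enc_nat_1[simplified])
  show "pt e (e_list enc_lit) g \<Longrightarrow> pt e enc_dt h \<Longrightarrow>
      pt e enc_dt (\<lambda>x. fold (\<lambda>q A. Dec (DLit q) q A) (g x) (h x))"
    by (rule pt_fold[where F = "\<lambda>q A. Node (enc_nat 1) (Node (Node Leaf q) (Node q A))" and c = 10])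
      (intro polytime_Node polytime_dfst polytime_dsnd polytime_const polytime_id,
        simp_all add: enc_nat_1[simplified])
qed

text \<open>\<open>pt_fold\<close> takes a step function independent of the environment, so the test
  of \<open>d\<close> has to leave the fold.\<close>

lemma conv_eq: "conv d ls = (case rev ls of [] \<Rightarrow> DLit (Pos 0) | p # ps \<Rightarrow>
    if d then fold (\<lambda>q A. Dec A q (DLit q)) ps (DLit p) else fold (\<lambda>q A. Dec (DLit q) q A) ps (DLit p))"
  by (cases d) (simp_all add: conv_def cong: list.case_cong)

lemma pt_form0: "pt e_item enc_dt (\<lambda>x. form x)"
  unfolding form_def[abs_def] conv_eq by (rule pt_rules pt_fold_Dec pt_DLit)+

lemmas pt_form = pt_comp[where f = form, OF pt_form0]

lemma pt_toseq: "pt e (e_list e_item) f \<Longrightarrow> pt e (enc_seq enc_dt) (\<lambda>x. toseq (f x))"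
  unfolding toseq_def enc_seq_eq by (rule pt_rules pt_form | assumption)+

primrec children :: "'s ptree \<Rightarrow> 's ptree list" where
  "children (Infer S ts) = ts"

lemma enc_tree_eq: "enc_tree a t = Node (enc_seq a (root t)) (e_list (enc_tree a) (children t))"
  by (cases t) (simp add: e_list_def)

lemma pt_root: "pt e (enc_tree a) f \<Longrightarrow> pt e (enc_seq a) (\<lambda>x. root (f x))"
  by (rule pt_comp[where f = root], rule ptI[OF polytime_dfst[OF polytime_id]])
    (simp_all add: enc_tree_eq)

lemma pt_children: "pt e (enc_tree a) f \<Longrightarrow> pt e (e_list (enc_tree a)) (\<lambda>x. children (f x))"
  by (rule pt_comp[where f = children], rule ptI[OF polytime_dsnd[OF polytime_id]])
    (simp_all add: enc_tree_eq)

lemma pt_preorder: "pt (enc_tree a) (e_list (enc_tree a)) (\<lambda>t. rev (preorder t))"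
proof (rule pt_worklist[where kids = children])
  show "pt (enc_tree a) (e_list (enc_tree a)) children" by (rule pt_children[OF pt_id])
  show "polytime dsnd" using polytime_dsnd[OF polytime_id] .
  show "dsnd (enc_tree a t) = e_list (enc_tree a) (children t)" for t by (simp add: enc_tree_eq)
  show "preorder t = t # concat (map preorder (children t))" for t :: "'b lsequent ptree"
    by (cases t) simp
qed (rule size_dsnd)

lemma pt_tree_code: "pt (enc_tree enc_bf) e_code tree_code"
proof -
  have "pt (enc_tree enc_bf) e_code (\<lambda>\<tau>. concat (map (\<lambda>t.
      tree_node (items_of (root t)) (map (\<lambda>t'. items_of (root t')) (children t))) (rev (preorder \<tau>))))"
    by (rule pt_preorder pt_const pt_concat_map pt_map pt_tree_node pt_items_of pt_root pt_children
      pt_snd pt_fst pt_id)+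
  moreover have "tree_node (items_of (root t)) (map (\<lambda>t'. items_of (root t')) (children t)) =
      (case t of Infer S ts \<Rightarrow> tree_node (items_of S) (map (\<lambda>t'. items_of (root t')) ts))" for t
    by (cases t) simp
  ultimately show ?thesis by (simp add: tree_code_def[abs_def])
qed

text \<open>Subtrees are moved and never copied, so a step adds no more than the sequent of its
  instruction and a few cells.\<close>

lemma pt_fold_exec_step:
  assumes "pt e (e_list (e_pair e_instr (enc_seq enc_dt))) f"
  shows "pt e (e_list (enc_tree enc_dt)) (\<lambda>x. fold exec_step (f x) [])"
proof (rule pt_fold[OF _ _ _ assms pt_const])
  let ?F = "\<lambda>i s. if dfst i = Leaf then Node (Node (dsnd i) Leaf) s
    else if s = Leaf then s
    else if dfst i = e_instr Unary then Node (Node (dsnd i) (Node (dfst s) Leaf)) (dsnd s)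
    else if dsnd s = Leaf then s
    else if dfst i = e_instr (Binary True)
      then Node (Node (dsnd i) (Node (dfst s) (Node (dfst (dsnd s)) Leaf))) (dsnd (dsnd s))
    else if dfst i = e_instr (Binary False)
      then Node (Node (dsnd i) (Node (dfst (dsnd s)) (Node (dfst s) Leaf))) (dsnd (dsnd s))
    else if dfst i = e_instr Nip then Node (dfst s) (dsnd (dsnd s))
    else Node (dfst (dsnd s)) (Node (dfst s) (dsnd (dsnd s)))"
  show "polytime (\<lambda>d. ?F (dfst d) (dsnd d))"
    by (intro polytime_if_eq polytime_Node polytime_dfst polytime_dsnd polytime_const polytime_id)
  show "size (?F i s) \<le> size s + 5 * Suc (size i)" for i s
  proof -
    have "size (dsnd i) \<le> size i" by (rule size_dsnd)
    then show ?thesis by (cases s; cases "dsnd s") auto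
  qed
  show "?F (e_pair e_instr (enc_seq enc_dt) i) (e_list (enc_tree enc_dt) ts)
      = e_list (enc_tree enc_dt) (exec_step i ts)" for i ts
  proof -
    have Push: "e_instr i = Leaf \<longleftrightarrow> i = Push" for i using inj_eq[OF inj_e_instr, of i Push] by simp
    have tree: "enc_tree enc_dt (Infer S us) = Node (enc_seq enc_dt S) (e_list (enc_tree enc_dt) us)"
      for S us by (simp add: enc_tree_eq)
    have null: "e_list a xs = Leaf \<longleftrightarrow> xs = []" for a :: "'c \<Rightarrow> data" and xs by (cases xs) auto
    show ?thesis
      by (cases ts; cases "tl ts")
        (auto simp: exec_step_def e_pair_def Push inj_eq[OF inj_e_instr] tree null
          simp del: e_instr.simps enc_tree.simps)
  qed
qed

lemma pt_exec: "pt e e_code f \<Longrightarrow> pt e (e_list (enc_tree enc_dt)) (\<lambda>x. exec (f x))"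
  unfolding exec_def by (rule pt_fold_exec_step pt_rules pt_toseq | assumption)+

lemma sq_items_of_conclusion:
  assumes "list_all2 is_Or as \<Gamma>" "list_all2 is_And bs \<Delta>" "seq_of S = (mset \<Gamma>, mset \<Delta>)"
  shows "sq (items_of S) = (mset (map Disj as), mset (map Conj bs))"
proof -
  have "map (\<lambda>A. form (item_of False A)) \<Gamma> = map Disj as"
    using assms(1) by (induction rule: list_all2_induct) (simp_all add: form_Disj)
  moreover have "map (\<lambda>A. form (item_of True A)) \<Delta> = map Conj bs"
    using assms(2) by (induction rule: list_all2_induct) (simp_all add: form_Conj)
  ultimately show ?thesis using assms(3) by (simp add: sq_items_of seq_of_def flip: mset_map)
qed

theorem theorem3p9:
  shows
    "(\<exists>F. polytime F \<and>
        (\<forall>(\<pi> :: bf lsequent list) (as :: lit list list) (bs :: lit list list) \<Gamma> \<Delta>.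
           list_all2 is_Or as \<Gamma> \<longrightarrow> list_all2 is_And bs \<Delta> \<longrightarrow>
           dag_proof lk1_inf (map seq_of \<pi>) (mset \<Gamma>, mset \<Delta>) \<longrightarrow>
           (\<exists>\<pi>' :: dt lsequent list.
              F (enc_dag enc_bf \<pi>) = enc_dag enc_dt \<pi>' \<and>
              dag_proof ldt_inf (map seq_of \<pi>') (mset (map Disj as), mset (map Conj bs)))))
     \<and>
     (\<exists>G. polytime G \<and>
        (\<forall>(\<tau> :: bf lsequent ptree) (as :: lit list list) (bs :: lit list list) \<Gamma> \<Delta>.
           list_all2 is_Or as \<Gamma> \<longrightarrow> list_all2 is_And bs \<Delta> \<longrightarrow>
           tree_proof lk1_inf (map_ptree seq_of \<tau>) (mset \<Gamma>, mset \<Delta>) \<longrightarrow>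
           (\<exists>\<tau>' :: dt lsequent ptree.
              G (enc_tree enc_bf \<tau>) = enc_tree enc_dt \<tau>' \<and>
              tree_proof ldt_inf (map_ptree seq_of \<tau>') (mset (map Disj as), mset (map Conj bs)))))"
proof (intro conjI)
  let ?f = "\<lambda>\<pi>. map toseq (lines (dag_code (map items_of \<pi>)))"
  have "pt (e_list (enc_seq enc_bf)) (e_list (enc_seq enc_dt)) ?f"
    by (rule pt_map pt_lines pt_dag_code pt_toseq pt_items_of pt_snd pt_id)+
  then obtain F where F: "polytime F" "\<And>\<pi>. F (enc_dag enc_bf \<pi>) = enc_dag enc_dt (?f \<pi>)"
    by (rule ptE) (simp add: e_list_def enc_dag_def)
  show "\<exists>F. polytime F \<and>
        (\<forall>(\<pi> :: bf lsequent list) (as :: lit list list) (bs :: lit list list) \<Gamma> \<Delta>.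
           list_all2 is_Or as \<Gamma> \<longrightarrow> list_all2 is_And bs \<Delta> \<longrightarrow>
           dag_proof lk1_inf (map seq_of \<pi>) (mset \<Gamma>, mset \<Delta>) \<longrightarrow>
           (\<exists>\<pi>' :: dt lsequent list.
              F (enc_dag enc_bf \<pi>) = enc_dag enc_dt \<pi>' \<and>
              dag_proof ldt_inf (map seq_of \<pi>') (mset (map Disj as), mset (map Conj bs))))"
  proof (intro exI[of _ F] conjI allI impI F(1))
    fix \<pi> :: "bf lsequent list" and as bs :: "lit list list" and \<Gamma> \<Delta>
    assume as: "list_all2 is_Or as \<Gamma>" and bs: "list_all2 is_And bs \<Delta>"
      and \<pi>: "dag_proof lk1_inf (map seq_of \<pi>) (mset \<Gamma>, mset \<Delta>)"
    have "seq_of (last \<pi>) = (mset \<Gamma>, mset \<Delta>)" using \<pi> by (auto simp: dag_proof_def last_map)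
    from sq_items_of_conclusion[OF as bs this] dag_code_proof[OF \<pi>]
    have "dag_proof ldt_inf (map seq_of (?f \<pi>)) (mset (map Disj as), mset (map Conj bs))"
      by (simp add: comp_def sq_def[abs_def])
    with F(2) show "\<exists>\<pi>'. F (enc_dag enc_bf \<pi>) = enc_dag enc_dt \<pi>' \<and>
        dag_proof ldt_inf (map seq_of \<pi>') (mset (map Disj as), mset (map Conj bs))" by blast
  qed
next
  \<comment> \<open>On a proof the final stack is a singleton; the tree given for the empty stack
    only makes the function total.\<close>
  let ?g = "\<lambda>\<tau>. case exec (tree_code \<tau>) of [] \<Rightarrow> Infer ([], []) [] | t # _ \<Rightarrow> t"
  have "pt (enc_tree enc_bf) (enc_tree enc_dt) ?g"
    by (rule pt_const pt_case_list pt_exec pt_tree_code pt_fst pt_snd pt_id)+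
  then obtain G where G: "polytime G" "\<And>\<tau>. G (enc_tree enc_bf \<tau>) = enc_tree enc_dt (?g \<tau>)"
    by (rule ptE) (rule that)
  show "\<exists>G. polytime G \<and>
        (\<forall>(\<tau> :: bf lsequent ptree) (as :: lit list list) (bs :: lit list list) \<Gamma> \<Delta>.
           list_all2 is_Or as \<Gamma> \<longrightarrow> list_all2 is_And bs \<Delta> \<longrightarrow>
           tree_proof lk1_inf (map_ptree seq_of \<tau>) (mset \<Gamma>, mset \<Delta>) \<longrightarrow>
           (\<exists>\<tau>' :: dt lsequent ptree.
              G (enc_tree enc_bf \<tau>) = enc_tree enc_dt \<tau>' \<and>
              tree_proof ldt_inf (map_ptree seq_of \<tau>') (mset (map Disj as), mset (map Conj bs))))"
  proof (intro exI[of _ G] conjI allI impI G(1))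
    fix \<tau> :: "bf lsequent ptree" and as bs :: "lit list list" and \<Gamma> \<Delta>
    assume as: "list_all2 is_Or as \<Gamma>" and bs: "list_all2 is_And bs \<Delta>"
      and \<tau>: "tree_proof lk1_inf (map_ptree seq_of \<tau>) (mset \<Gamma>, mset \<Delta>)"
    have "seq_of (root \<tau>) = (mset \<Gamma>, mset \<Delta>)" using \<tau> by (simp add: tree_proof_def ptree.map_sel)
    note sq = sq_items_of_conclusion[OF as bs this]
    obtain t where t: "exec (tree_code \<tau>) = [t]"
      "tree_proof ldt_inf (map_ptree seq_of t) (sq (items_of (root \<tau>)))"
      using \<tau> by (rule exec_tree_code)
    then show "\<exists>\<tau>'. G (enc_tree enc_bf \<tau>) = enc_tree enc_dt \<tau>' \<and>
        tree_proof ldt_inf (map_ptree seq_of \<tau>') (mset (map Disj as), mset (map Conj bs))"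
      using G(2)[of \<tau>] sq by (intro exI[of _ t]) simp
  qed
qed

end
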